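(* Assume the Continuum Hypothesis. Then there is a crowded, zero-dimensional Hausdorff topological space $X$ which is $Nwd_\omega(X)$-selectively pseudocompact but not $Scat_\omega(X)$-selectively pseudocompact, where $Scat_\omega(X)$ is the family of countably infinite scattered subsets of $X$ and $Nwd_\omega(X)$ is the family of countably infinite nowhere dense subsets of $X$.
   Context: For a topological space $X$ and $\mathcal A\subseteq\mathcal P(X)$, $X$ is called $\mathcal A$-selectively pseudocompact if for every sequence $\langle U_n:n\in\omega\rangle$ of pairwise disjoint non-empty open subsets of $X$ one can choose sets $A_n\in\mathcal A$ with $A_n\subseteq U_n$ such that the family $\{A_n:n\in\omega\}$ has an accumulation point, i.e. there is a point $x\in X$ every neighbourhood of which meets $A_n$ for infinitely many $n$. A space is crowded if it has no isolated points. A set is scattered if each of its non-empty subsets has a point isolated in that subset. *)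

theory Defs
  imports "HOL-Analysis.Analysis" "HOL-Library.Equipollence"
begin

definition continuum_hypothesis :: bool where
  "continuum_hypothesis \<longleftrightarrow> (\<forall>S :: real set. countable S \<or> S \<approx> (UNIV :: real set))"

definition crowded_space :: "'a topology \<Rightarrow> bool" where
  "crowded_space X \<longleftrightarrow> (\<forall>x \<in> topspace X. \<not> openin X {x})"

definition scattered_in :: "'a topology \<Rightarrow> 'a set \<Rightarrow> bool" where
  "scattered_in X S \<longleftrightarrow>
     (\<forall>T. T \<subseteq> S \<and> T \<noteq> {} \<longrightarrow> (\<exists>x \<in> T. \<exists>U. openin X U \<and> U \<inter> T = {x}))"

definition nowhere_dense_in :: "'a topology \<Rightarrow> 'a set \<Rightarrow> bool" where
  "nowhere_dense_in X S \<longleftrightarrow> X interior_of (X closure_of S) = {}"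

definition Scat_omega :: "'a topology \<Rightarrow> 'a set set" where
  "Scat_omega X = {S. S \<subseteq> topspace X \<and> countable S \<and> infinite S \<and> scattered_in X S}"

definition Nwd_omega :: "'a topology \<Rightarrow> 'a set set" where
  "Nwd_omega X = {S. S \<subseteq> topspace X \<and> countable S \<and> infinite S \<and> nowhere_dense_in X S}"

definition family_accumulation_point :: "'a topology \<Rightarrow> (nat \<Rightarrow> 'a set) \<Rightarrow> 'a \<Rightarrow> bool" where
  "family_accumulation_point X A x \<longleftrightarrow>
     x \<in> topspace X \<and> (\<forall>V. openin X V \<and> x \<in> V \<longrightarrow> infinite {n. A n \<inter> V \<noteq> {}})"

definition selectively_pseudocompact :: "'a topology \<Rightarrow> 'a set set \<Rightarrow> bool" where
  "selectively_pseudocompact X \<A> \<longleftrightarrow>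
     (\<forall>U :: nat \<Rightarrow> 'a set.
        (\<forall>n. openin X (U n) \<and> U n \<noteq> {}) \<and> (\<forall>m n. m \<noteq> n \<longrightarrow> U m \<inter> U n = {}) \<longrightarrow>
        (\<exists>A :: nat \<Rightarrow> 'a set. (\<forall>n. A n \<in> \<A> \<and> A n \<subseteq> U n) \<and>
           (\<exists>x. family_accumulation_point X A x)))"

end

theory Submission
  imports Defs
begin

text \<open>
  The space is built on \<open>\<nat> \<union> \<omega>\<^sub>1\<close> by adding clopen generators \<open>G \<delta>\<close>, one at each stage
  \<open>\<delta> < \<omega>\<^sub>1\<close>. A \<^emph>\<open>promise\<close> is a pair \<open>(x, A)\<close> with \<open>A \<subseteq> \<nat>\<close> such that every neighbourhood of every
  point of \<open>A \<union> {x}\<close> is to meet \<open>A\<close> in an infinite set, now and at all later stages. At each stage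
  only countably many promises and basic sets \<open>B\<close> exist. If \<open>D\<close> is scattered, then each
  \<open>A \<inter> B - D\<close> is infinite, and one set \<open>S\<close> splits all these infinite sets; hence the generator
  \<open>D \<union> (S - {y})\<close> keeps every promise and separates \<open>D\<close> from \<open>y\<close>. By CH all pairs \<open>(D, y)\<close> with
  \<open>D\<close> countable are treated, so in the end countable scattered sets are closed and no family of them
  inside disjoint open sets accumulates. Conversely \<open>\<nat>\<close> is a union of nowhere dense
  sets \<open>F i\<close> that are promised to stay crowded, and the point \<open>\<delta>\<close> starts as an ultrafilter limit of
  points of prescribed sets \<open>W n = F (i n) \<inter> B n\<close>, with the promise that it stays an accumulation
  point of them.
\<close>

section \<open>Splitting sets and free ultrafilters\<close>

text \<open>The sequence \<open>t\<close> lists every member of \<open>\<E>\<close> infinitely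
  often, each time at two consecutive indices. A strictly increasing choice \<open>p\<close> from
  \<open>t\<close> is divided by parity: the even positions form \<open>S\<close>, the odd ones stay
  outside it by injectivity.\<close>

lemma countable_family_split:
  fixes \<E> :: "nat set set"
  assumes "countable \<E>" and inf: "\<And>A. A \<in> \<E> \<Longrightarrow> infinite A"
  obtains S where "\<And>A. A \<in> \<E> \<Longrightarrow> infinite (A \<inter> S) \<and> infinite (A - S)"
proof (cases "\<E> = {}")
  case True
  then show ?thesis using that by blast
next
  case False
  define t where "t i = from_nat_into \<E> (fst (prod_decode (i div 2)))" for i
  have t: "infinite (t i)" for i
    unfolding t_def using inf from_nat_into [OF False] by blast
  have "\<exists>p. \<forall>i. p i \<in> t i \<and> p i < p (Suc i)"
  proof (rule dependent_nat_choice)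
    show "\<exists>x. x \<in> t 0" using t [of 0] by (metis finite.emptyI ex_in_conv)
    show "\<exists>y. y \<in> t (Suc i) \<and> x < y" for x i
      using t [of "Suc i"] by (metis infinite_nat_iff_unbounded)
  qed
  then obtain p where p: "\<And>i. p i \<in> t i" "\<And>i. p i < p (Suc i)" by blast
  then have inj: "inj p"
    by (simp add: lift_Suc_mono_less_iff strict_mono_Suc_iff strict_mono_imp_inj_on)
  show ?thesis
  proof (rule that [of "range (\<lambda>i. p (2 * i))"])
    fix A assume "A \<in> \<E>"
    then obtain m where m: "A = from_nat_into \<E> m"
      by (metis assms(1) from_nat_into_surj)
    let ?q = "\<lambda>k. 2 * prod_encode (m, k)"
    have "range (\<lambda>k. p (?q k)) \<subseteq> A \<inter> range (\<lambda>i. p (2 * i))"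
      using p(1) [of "?q _"] by (auto simp: t_def m)
    moreover have "inj (\<lambda>k. p (?q k))"
      by (rule injI) (simp add: inj_eq [OF inj])
    moreover have "p (Suc (?q k)) \<in> A - range (\<lambda>i. p (2 * i))" for k
    proof -
      have "Suc (?q k) \<noteq> 2 * i" for i by presburger
      then show ?thesis
        using p(1) [of "Suc (?q k)"] inj by (auto simp: t_def m inj_eq)
    qed
    moreover have "inj (\<lambda>k. p (Suc (?q k)))"
      by (rule injI) (simp add: inj_eq [OF inj])
    ultimately show "infinite (A \<inter> range (\<lambda>i. p (2 * i))) \<and> infinite (A - range (\<lambda>i. p (2 * i)))"
      by (meson image_subsetI infinite_super range_inj_infinite)
  qed
qed

text \<open>Zorn's lemma is applied to families whose finite intersections are all infinite; this
  builds in freeness, and the ultrafilter laws follow from maximality.\<close>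

lemma free_ultrafilter_exists:
  "\<exists>U :: nat set set. (\<forall>A\<in>U. infinite A) \<and> (\<forall>A B. A \<inter> B \<in> U \<longleftrightarrow> A \<in> U \<and> B \<in> U) \<and>
    (\<forall>A. - A \<in> U \<longleftrightarrow> A \<notin> U)"
proof -
  let ?Z = "{F :: nat set set. \<forall>K. finite K \<and> K \<subseteq> F \<longrightarrow> infinite (\<Inter>K)}"
  have "{} \<in> ?Z" by auto
  have Zorn: "\<exists>M\<in>?Z. \<forall>X\<in>?Z. M \<subseteq> X \<longrightarrow> X = M"
  proof (rule subset_Zorn_nonempty)
    show "?Z \<noteq> {}" using \<open>{} \<in> ?Z\<close> by blast
    fix \<C> assume \<C>: "\<C> \<noteq> {}" "subset.chain ?Z \<C>"
    have "infinite (\<Inter>K)" if K: "finite K" "K \<subseteq> \<Union>\<C>" for K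
    proof -
      obtain F where "F \<in> \<C>" "K \<subseteq> F"
        using finite_subset_Union_chain [OF K \<C>] by blast
      then show ?thesis
        using \<C>(2) K(1) by (auto simp: subset_chain_def)
    qed
    then show "\<Union>\<C> \<in> ?Z" by blast
  qed
  from Zorn obtain M where M: "M \<in> ?Z" and max: "\<forall>X\<in>?Z. M \<subseteq> X \<longrightarrow> X = M" by (rule bexE)
  have inf: "infinite (\<Inter>K)" if "finite K" "K \<subseteq> M" for K
    using M that by simp
  \<comment> \<open>By maximality a set belongs to \<open>M\<close> as soon as adding it makes no
    finite intersection finite.\<close>
  have mem: "A \<in> M \<longleftrightarrow> (\<forall>K. finite K \<and> K \<subseteq> M \<longrightarrow> infinite (\<Inter>K \<inter> A))" for A
  proof
    assume "A \<in> M"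
    show "\<forall>K. finite K \<and> K \<subseteq> M \<longrightarrow> infinite (\<Inter>K \<inter> A)"
    proof (intro allI impI)
      fix K assume "finite K \<and> K \<subseteq> M"
      then have "infinite (\<Inter>(insert A K))" using \<open>A \<in> M\<close> by (intro inf) auto
      then show "infinite (\<Inter>K \<inter> A)" by (simp add: Int_commute)
    qed
  next
    assume *: "\<forall>K. finite K \<and> K \<subseteq> M \<longrightarrow> infinite (\<Inter>K \<inter> A)"
    have "infinite (\<Inter>K)" if "finite K" "K \<subseteq> insert A M" for K
    proof -
      have "infinite (\<Inter>(K - {A}) \<inter> A)" using * that by blast
      moreover have "\<Inter>(K - {A}) \<inter> A \<subseteq> \<Inter>K" by auto
      ultimately show ?thesis using infinite_super by blast
    qed
    then have "insert A M = M" by (intro max [rule_format]) auto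
    then show "A \<in> M" by blast
  qed
  show ?thesis
  proof (intro exI [of _ M] conjI ballI allI)
    show "infinite A" if "A \<in> M" for A
      using that mem [of A] by (metis finite.emptyI empty_subsetI Inf_empty inf_top.left_neutral)
    show "A \<inter> B \<in> M \<longleftrightarrow> A \<in> M \<and> B \<in> M" for A B
    proof (intro iffI conjI)
      assume AB: "A \<inter> B \<in> M"
      have "infinite (\<Inter>K \<inter> A) \<and> infinite (\<Inter>K \<inter> B)" if "finite K \<and> K \<subseteq> M" for K
      proof -
        have "infinite (\<Inter>K \<inter> (A \<inter> B))" using AB mem [of "A \<inter> B"] that by simp
        then show ?thesis by (metis Int_left_commute finite_Int inf_commute)
      qed
      then show "A \<in> M" "B \<in> M" by (simp_all add: mem)
    next
      assume AB: "A \<in> M \<and> B \<in> M"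
      have "infinite (\<Inter>K \<inter> (A \<inter> B))" if "finite K \<and> K \<subseteq> M" for K
      proof -
        have "finite (insert A K) \<and> insert A K \<subseteq> M" using AB that by simp
        moreover have "\<forall>L. finite L \<and> L \<subseteq> M \<longrightarrow> infinite (\<Inter>L \<inter> B)" using AB mem by simp
        ultimately have "infinite (\<Inter>(insert A K) \<inter> B)" by iprover
        then show ?thesis by (simp add: Int_ac)
      qed
      then show "A \<inter> B \<in> M" by (simp add: mem [of "A \<inter> B"])
    qed
    show "- A \<in> M \<longleftrightarrow> A \<notin> M" for A
    proof
      assume "- A \<in> M"
      show "A \<notin> M"
      proof
        assume "A \<in> M"
        then have "infinite (\<Inter>{A, - A})" using \<open>- A \<in> M\<close> by (intro inf) auto
        then show False by simp
      qed
    next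
      assume "A \<notin> M"
      then obtain K where K: "finite K" "K \<subseteq> M" "finite (\<Inter>K \<inter> A)" using mem [of A] by auto
      \<comment> \<open>If \<open>A\<close> is blocked by \<open>K\<close> and \<open>- A\<close> by
        \<open>L\<close>, then \<open>K \<union> L\<close> would have a finite intersection.\<close>
      have "infinite (\<Inter>L \<inter> - A)" if L: "finite L \<and> L \<subseteq> M" for L
      proof
        assume "finite (\<Inter>L \<inter> - A)"
        then have "finite ((\<Inter>K \<inter> A) \<union> (\<Inter>L \<inter> - A))" using K(3) by simp
        moreover have "\<Inter>(K \<union> L) \<subseteq> (\<Inter>K \<inter> A) \<union> (\<Inter>L \<inter> - A)" by blast
        ultimately have "finite (\<Inter>(K \<union> L))" using finite_subset by blast
        then show False using inf [of "K \<union> L"] K L by simp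
      qed
      then show "- A \<in> M" by (simp add: mem [of "- A"])
    qed
  qed
qed

section \<open>Zero-dimensional topologies generated by clopen sets\<close>

text \<open>Basic open sets of the coarsest topology in which every member of \<open>\<G>\<close> is
  clopen.\<close>

definition cylinders :: "'a set set \<Rightarrow> 'a set set" where
  "cylinders \<G> = {\<Inter>F - \<Union>K | F K. finite F \<and> finite K \<and> F \<subseteq> \<G> \<and> K \<subseteq> \<G>}"

lemma cylindersI:
  "finite F \<Longrightarrow> finite K \<Longrightarrow> F \<subseteq> \<G> \<Longrightarrow> K \<subseteq> \<G> \<Longrightarrow> \<Inter>F - \<Union>K \<in> cylinders \<G>"
  by (auto simp: cylinders_def)

lemma UNIV_in_cylinders: "UNIV \<in> cylinders \<G>"
  using cylindersI [of "{}" "{}"] by simp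

lemma generator_in_cylinders: "g \<in> \<G> \<Longrightarrow> g \<in> cylinders \<G>"
  using cylindersI [of "{g}" "{}"] by simp

lemma Compl_generator_in_cylinders: "g \<in> \<G> \<Longrightarrow> - g \<in> cylinders \<G>"
  using cylindersI [of "{}" "{g}"] by (simp add: Compl_eq_Diff_UNIV)

lemma Int_in_cylinders:
  assumes "A \<in> cylinders \<G>" "B \<in> cylinders \<G>"
  shows "A \<inter> B \<in> cylinders \<G>"
proof -
  obtain F K F' K' where "finite F" "finite K" "F \<subseteq> \<G>" "K \<subseteq> \<G>" "A = \<Inter>F - \<Union>K"
      "finite F'" "finite K'" "F' \<subseteq> \<G>" "K' \<subseteq> \<G>" "B = \<Inter>F' - \<Union>K'"
    using assms by (auto simp: cylinders_def)
  moreover from this have "A \<inter> B = \<Inter>(F \<union> F') - \<Union>(K \<union> K')" by auto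
  ultimately show ?thesis
    using cylindersI [of "F \<union> F'" "K \<union> K'" \<G>] by simp
qed

lemma cylinders_mono: "\<G> \<subseteq> \<G>' \<Longrightarrow> cylinders \<G> \<subseteq> cylinders \<G>'"
  unfolding cylinders_def by blast

lemma countable_cylinders: "countable \<G> \<Longrightarrow> countable (cylinders \<G>)"
proof -
  assume \<G>: "countable \<G>"
  let ?\<F> = "{F. finite F \<and> F \<subseteq> \<G>}"
  have "countable (?\<F> \<times> ?\<F>)"
    using countable_Collect_finite_subset [OF \<G>] by blast
  moreover have "cylinders \<G> = (\<lambda>(F, K). \<Inter>F - \<Union>K) ` (?\<F> \<times> ?\<F>)"
    by (auto simp: cylinders_def)
  ultimately show ?thesis by simp
qed

text \<open>With generators indexed by stages, this confines a basic set to finitely many stages and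
  hence below a bound.\<close>

lemma cylinder_finite_support:
  assumes "B \<in> cylinders (f ` J)"
  obtains K where "finite K" "K \<subseteq> J" "B \<in> cylinders (f ` K)"
proof -
  obtain F L where FL: "finite F" "finite L" "F \<subseteq> f ` J" "L \<subseteq> f ` J" "B = \<Inter>F - \<Union>L"
    using assms by (auto simp: cylinders_def)
  obtain K1 where "K1 \<subseteq> J" "finite K1" "F = f ` K1" using FL finite_subset_image by metis
  moreover obtain K2 where "K2 \<subseteq> J" "finite K2" "L = f ` K2" using FL finite_subset_image by metis
  ultimately show ?thesis
    using that [of "K1 \<union> K2"] FL(5) by (metis cylindersI finite_UnI finite_imageI image_mono le_sup_iff sup_ge1 sup_ge2)
qed

text \<open>Reduces a promise about the enlarged family to the traces of old basic sets on
  \<open>g\<close> and on its complement.\<close>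

lemma cylinder_insert:
  assumes "B \<in> cylinders (insert g \<G>)" "x \<in> B"
  obtains C where "C \<in> cylinders \<G>" "x \<in> C" "x \<in> g \<Longrightarrow> C \<inter> g \<subseteq> B" "x \<notin> g \<Longrightarrow> C - g \<subseteq> B"
proof -
  obtain F L where FL: "finite F" "finite L" "F \<subseteq> insert g \<G>" "L \<subseteq> insert g \<G>" "B = \<Inter>F - \<Union>L"
    using assms by (auto simp: cylinders_def)
  show ?thesis
  proof (rule that [of "\<Inter>(F - {g}) - \<Union>(L - {g})"])
    show "\<Inter>(F - {g}) - \<Union>(L - {g}) \<in> cylinders \<G>"
      using FL by (intro cylindersI) auto
  qed (use FL assms(2) in auto)
qed

lemma cylinder_complement_nhd:
  assumes "B \<in> cylinders \<G>" "x \<notin> B"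
  obtains C where "C \<in> cylinders \<G>" "x \<in> C" "C \<inter> B = {}"
proof -
  obtain F L where FL: "F \<subseteq> \<G>" "L \<subseteq> \<G>" "B = \<Inter>F - \<Union>L"
    using assms by (auto simp: cylinders_def)
  then consider g where "g \<in> F" "x \<notin> g" | g where "g \<in> L" "x \<in> g" using assms(2) by blast
  then show ?thesis
  proof cases
    case 1
    then show ?thesis using that [of "- g"] Compl_generator_in_cylinders FL by blast
  next
    case 2
    then show ?thesis using that [of g] generator_in_cylinders FL by blast
  qed
qed

definition cylinder_topology :: "'a set set \<Rightarrow> 'a topology" where
  "cylinder_topology \<G> = topology (\<lambda>U. \<forall>x\<in>U. \<exists>B\<in>cylinders \<G>. x \<in> B \<and> B \<subseteq> U)"

lemma openin_cylinder_topology: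
  "openin (cylinder_topology \<G>) U \<longleftrightarrow> (\<forall>x\<in>U. \<exists>B\<in>cylinders \<G>. x \<in> B \<and> B \<subseteq> U)"
proof -
  have "istopology (\<lambda>U. \<forall>x\<in>U. \<exists>B\<in>cylinders \<G>. x \<in> B \<and> B \<subseteq> U)"
    unfolding istopology_def
  proof (intro conjI allI impI ballI)
    fix S T x assume "\<forall>x\<in>S. \<exists>B\<in>cylinders \<G>. x \<in> B \<and> B \<subseteq> S"
      "\<forall>x\<in>T. \<exists>B\<in>cylinders \<G>. x \<in> B \<and> B \<subseteq> T" "x \<in> S \<inter> T"
    then obtain A B where "A \<in> cylinders \<G>" "x \<in> A" "A \<subseteq> S" "B \<in> cylinders \<G>" "x \<in> B" "B \<subseteq> T"
      by blast
    then show "\<exists>B\<in>cylinders \<G>. x \<in> B \<and> B \<subseteq> S \<inter> T"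
      using Int_in_cylinders by (intro bexI [of _ "A \<inter> B"]) auto
  next
    fix \<K> x assume "\<forall>K\<in>\<K>. \<forall>x\<in>K. \<exists>B\<in>cylinders \<G>. x \<in> B \<and> B \<subseteq> K" "x \<in> \<Union>\<K>"
    then show "\<exists>B\<in>cylinders \<G>. x \<in> B \<and> B \<subseteq> \<Union>\<K>" by (meson UnionE Union_upper subset_trans)
  qed
  then show ?thesis by (simp add: cylinder_topology_def topology_inverse')
qed

lemma topspace_cylinder_topology [simp]: "topspace (cylinder_topology \<G>) = UNIV"
  using openin_subset [of "cylinder_topology \<G>" UNIV] UNIV_in_cylinders
  by (auto simp: openin_cylinder_topology)

lemma openin_cylinder: "B \<in> cylinders \<G> \<Longrightarrow> openin (cylinder_topology \<G>) B"
  by (auto simp: openin_cylinder_topology)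

lemma closedin_cylinder: "B \<in> cylinders \<G> \<Longrightarrow> closedin (cylinder_topology \<G>) B"
  unfolding closedin_def openin_cylinder_topology
proof (intro conjI ballI)
  fix x assume B: "B \<in> cylinders \<G>" and "x \<in> topspace (cylinder_topology \<G>) - B"
  then obtain C where "C \<in> cylinders \<G>" "x \<in> C" "C \<inter> B = {}"
    using cylinder_complement_nhd [of B \<G> x] by blast
  then show "\<exists>C\<in>cylinders \<G>. x \<in> C \<and> C \<subseteq> topspace (cylinder_topology \<G>) - B"
    by auto
qed auto

lemma cylinder_topology_dim_le_0: "cylinder_topology \<G> dim_le 0"
  unfolding dimension_le_0_neighbourhood_base_of_clopen neighbourhood_base_of
proof (intro allI impI)
  fix W x assume "openin (cylinder_topology \<G>) W \<and> x \<in> W"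
  then obtain B where "B \<in> cylinders \<G>" "x \<in> B" "B \<subseteq> W"
    by (auto simp: openin_cylinder_topology)
  then show "\<exists>U V. openin (cylinder_topology \<G>) U \<and>
      (closedin (cylinder_topology \<G>) V \<and> openin (cylinder_topology \<G>) V) \<and> x \<in> U \<and> U \<subseteq> V \<and> V \<subseteq> W"
    using openin_cylinder closedin_cylinder by (intro exI [of _ B]) auto
qed

text \<open>
  \<open>D\<close> is scattered iff \<open>D \<subseteq> scattered_part \<G> D\<close>: the Cantor--Bendixson levels are collected from the
  isolated points upwards. For countable \<open>D\<close> this is witnessed by countably many generators, which
  the definition by subsets of \<open>D\<close> does not show.
\<close>

inductive_set scattered_part :: "'a set set \<Rightarrow> 'a set \<Rightarrow> 'a set" for \<G> D where
  "d \<in> D \<Longrightarrow> B \<in> cylinders \<G> \<Longrightarrow> d \<in> B \<Longrightarrow> (\<And>y. y \<in> B \<Longrightarrow> y \<in> D \<Longrightarrow> y \<noteq> d \<Longrightarrow> y \<in> scattered_part \<G> D)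
    \<Longrightarrow> d \<in> scattered_part \<G> D"

section \<open>Promises and generic generators\<close>

definition clusters :: "(nat + 'i) set set \<Rightarrow> nat + 'i \<Rightarrow> nat set \<Rightarrow> bool" where
  "clusters \<G> x A \<longleftrightarrow> (\<forall>B\<in>cylinders \<G>. x \<in> B \<longrightarrow> infinite {n \<in> A. Inl n \<in> B})"

text \<open>The points of \<open>A\<close> are required to cluster as well as \<open>x\<close>: a
  scattered set can be removed harmlessly because \<open>A\<close> has no isolated points of its
  own.\<close>

definition crowds :: "(nat + 'i) set set \<Rightarrow> nat + 'i \<Rightarrow> nat set \<Rightarrow> bool" where
  "crowds \<G> x A \<longleftrightarrow> (\<forall>y\<in>insert x (Inl ` A). clusters \<G> y A)"

lemma clustersD: "clusters \<G> x A \<Longrightarrow> B \<in> cylinders \<G> \<Longrightarrow> x \<in> B \<Longrightarrow> infinite {n \<in> A. Inl n \<in> B}"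
  by (simp add: clusters_def)

lemma crowds_clusters: "crowds \<G> x A \<Longrightarrow> clusters \<G> x A"
  by (simp add: crowds_def)

text \<open>Induction on the derivation of \<open>d \<in> scattered_part \<G> D\<close>: near
  \<open>d\<close> the set \<open>A\<close> has infinitely many points. Either one of them other
  than \<open>d\<close> lies in \<open>D\<close>, on an earlier level, and the induction hypothesis
  applies to it, or discarding \<open>d\<close> alone leaves the required infinite set.\<close>

lemma crowds_infinite_outside_scattered:
  assumes crowds: "crowds \<G> x A" and B: "B \<in> cylinders \<G>" "x \<in> B"
    and D: "D \<subseteq> scattered_part \<G> D"
  shows "infinite {n \<in> A. Inl n \<in> B - D}"
proof -
  have *: "infinite {n \<in> A. Inl n \<in> B - D}"
    if "d \<in> scattered_part \<G> D" "d \<in> Inl ` A" "d \<in> B" "B \<in> cylinders \<G>" for d B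
    using that
  proof (induction arbitrary: B)
    case (1 d C)
    then have inf: "infinite {n \<in> A. Inl n \<in> C \<inter> B}"
      using crowds by (intro clustersD [of \<G> d]) (auto simp: crowds_def Int_in_cylinders)
    show ?case
    proof (cases "\<exists>m\<in>A. Inl m \<in> C \<inter> B \<inter> D - {d}")
      case True
      then show ?thesis using 1 by blast
    next
      case False
      then have "{n \<in> A. Inl n \<in> C \<inter> B} - {n. Inl n = d} \<subseteq> {n \<in> A. Inl n \<in> B - D}" by auto
      moreover have "finite {n. Inl n = d}"
        by (rule finite_subset [of _ "{projl d}"]) auto
      ultimately show ?thesis
        using inf by (meson Diff_infinite_finite finite_subset)
    qed
  qed
  show ?thesis
  proof (cases "\<exists>m\<in>A. Inl m \<in> B \<inter> D")
    case True
    then show ?thesis using * B D by blast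
  next
    case False
    then have "{n \<in> A. Inl n \<in> B - D} = {n \<in> A. Inl n \<in> B}" by auto
    then show ?thesis using clustersD [OF crowds_clusters [OF crowds] B] by simp
  qed
qed

text \<open>\<open>S\<close> splits every infinite trace \<open>A \<inter> B - D\<close>, so a point
  keeps clustering whichever side of \<open>G\<close> it falls on. Clustering counts only naturals,
  so \<open>G\<close> is prescribed only there and remains free at the \<open>Inr\<close>
  points.\<close>

lemma generic_extension:
  fixes \<G> :: "(nat + 'i) set set"
  assumes "countable \<G>" "countable \<P>" and crowds: "\<And>x A. (x, A) \<in> \<P> \<Longrightarrow> crowds \<G> x A"
    and D: "D \<subseteq> scattered_part \<G> D"
  obtains S where "\<And>(G :: (nat + 'i) set) x A. (\<And>n. Inl n \<in> G \<longleftrightarrow> Inl n \<in> D \<or> n \<in> S \<and> Inl n \<noteq> y)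
    \<Longrightarrow> (x, A) \<in> \<P> \<Longrightarrow> crowds (insert G \<G>) x A"
proof -
  let ?E = "\<lambda>A B. {n \<in> A. Inl n \<in> B - D}"
  let ?\<E> = "{A \<in> (\<lambda>((x, A), B). ?E A B) ` (\<P> \<times> cylinders \<G>). infinite A}"
  have "countable ((\<lambda>((x, A), B). ?E A B) ` (\<P> \<times> cylinders \<G>))"
    using assms by (intro countable_image countable_SIGMA countable_cylinders)
  then have "countable ?\<E>" by (rule countable_subset [rotated]) auto
  then obtain S where S: "\<And>E. E \<in> ?\<E> \<Longrightarrow> infinite (E \<inter> S) \<and> infinite (E - S)"
    using countable_family_split [of ?\<E>] by blast
  show ?thesis
  proof (rule that [of S])
    fix G :: "(nat + 'i) set" and x A assume G: "\<And>n. Inl n \<in> G \<longleftrightarrow> Inl n \<in> D \<or> n \<in> S \<and> Inl n \<noteq> y" and xA: "(x, A) \<in> \<P>"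
    have "clusters (insert G \<G>) z A" if z: "z \<in> insert x (Inl ` A)" for z
      unfolding clusters_def
    proof (intro ballI impI)
      fix B assume "B \<in> cylinders (insert G \<G>)" "z \<in> B"
      then obtain C where C: "C \<in> cylinders \<G>" "z \<in> C"
        "z \<in> G \<Longrightarrow> C \<inter> G \<subseteq> B" "z \<notin> G \<Longrightarrow> C - G \<subseteq> B"
        using cylinder_insert by metis
      have "crowds \<G> z A" using crowds [OF xA] z by (auto simp: crowds_def)
      then have "infinite (?E A C)" using C D by (intro crowds_infinite_outside_scattered)
      then have "?E A C \<in> ?\<E>" using xA C(1) by force
      \<comment> \<open>Keeping \<open>y\<close> out of \<open>G\<close> costs at most one
        natural.\<close>
      then have inf: "infinite (?E A C \<inter> S - {n. Inl n = y})" "infinite (?E A C - S)"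
        using S [of "?E A C"] finite_subset [of "{n. Inl n = y}" "{projl y}"]
        by (force simp: Diff_infinite_finite)+
      show "infinite {n \<in> A. Inl n \<in> B}"
      proof (cases "z \<in> G")
        case True
        then have "?E A C \<inter> S - {n. Inl n = y} \<subseteq> {n \<in> A. Inl n \<in> B}" using C(3) G by blast
        then show ?thesis using inf(1) finite_subset by blast
      next
        case False
        then have "?E A C - S \<subseteq> {n \<in> A. Inl n \<in> B}" using C(4) G by blast
        then show ?thesis using inf(2) finite_subset by blast
      qed
    qed
    then show "crowds (insert G \<G>) x A" by (simp add: crowds_def)
  qed
qed

text \<open>
  A natural number codes a pair whose first component codes a finite set of bits. The fibers of the
  first component are closed and nowhere dense once the bits are clopen.
\<close>

definition fiber :: "nat \<Rightarrow> nat set" where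
  "fiber i = {n. fst (prod_decode n) = i}"

definition bit_set :: "nat \<Rightarrow> nat set" where
  "bit_set j = {n. j \<in> set_decode (fst (prod_decode n))}"

lemma infinite_fiber: "infinite (fiber i)"
proof -
  have "range (\<lambda>k. prod_encode (i, k)) \<subseteq> fiber i" by (auto simp: fiber_def)
  moreover have "inj (\<lambda>k. prod_encode (i, k))" by (auto simp: inj_on_def)
  ultimately show ?thesis using infinite_super range_inj_infinite by blast
qed

text \<open>Different codes decode to different finite sets of bits, and a bit is constant on a
  fiber. This makes fibers relatively closed among the naturals.\<close>

lemma distinct_fibers_separated_by_bit:
  assumes "a \<in> fiber i" "b \<notin> fiber i"
  obtains j where "b \<in> bit_set j" "fiber i \<inter> bit_set j = {}"
  | j where "b \<notin> bit_set j" "fiber i \<subseteq> bit_set j"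
proof -
  have "set_decode (fst (prod_decode b)) \<noteq> set_decode i"
    using assms set_decode_inverse by (metis (mono_tags, lifting) fiber_def mem_Collect_eq)
  then obtain j where "j \<in> set_decode (fst (prod_decode b)) \<longleftrightarrow> j \<notin> set_decode i" by blast
  then show ?thesis
    by (cases "j \<in> set_decode i") (auto simp: fiber_def bit_set_def intro: that(1) [of j] that(2) [of j])
qed

text \<open>Adding a fresh bit outside \<open>J\<close> to the code \<open>k\<close> changes no bit
  in \<open>J\<close>; taking it outside the bits of \<open>i\<close> as well keeps the new code
  different from \<open>i\<close>. Thus finitely many bits never single out one fiber.\<close>

lemma other_fiber_same_bits:
  assumes "finite J"
  obtains i' where "i' \<noteq> i" "\<And>j m n. j \<in> J \<Longrightarrow> m \<in> fiber k \<Longrightarrow> n \<in> fiber i' \<Longrightarrow> m \<in> bit_set j \<longleftrightarrow> n \<in> bit_set j"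
proof -
  let ?s = "set_decode k"
  obtain j where j: "j \<notin> J \<union> ?s \<union> set_decode i"
    using assms ex_new_if_finite [of "J \<union> ?s \<union> set_decode i"] by auto
  have dec: "set_decode (set_encode (insert j ?s)) = insert j ?s" by simp
  show ?thesis
  proof (rule that [of "set_encode (insert j ?s)"])
    show "set_encode (insert j ?s) \<noteq> i" using j dec by (metis UnCI insertI1)
    fix j' m n assume "j' \<in> J" "m \<in> fiber k" "n \<in> fiber (set_encode (insert j ?s))"
    then show "m \<in> bit_set j' \<longleftrightarrow> n \<in> bit_set j'" using j dec by (auto simp: fiber_def bit_set_def simp del: set_encode_inverse)
  qed
qed

section \<open>The transfinite construction\<close>

lemma cylinder_cong:
  assumes "B \<in> cylinders \<G>" "\<And>g. g \<in> \<G> \<Longrightarrow> x \<in> g \<longleftrightarrow> y \<in> g"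
  shows "x \<in> B \<longleftrightarrow> y \<in> B"
proof -
  obtain F K where "F \<subseteq> \<G>" "K \<subseteq> \<G>" "B = \<Inter>F - \<Union>K"
    using assms(1) by (auto simp: cylinders_def)
  then show ?thesis using assms(2) by blast
qed

lemma scattered_part_mono: "\<G> \<subseteq> \<G>' \<Longrightarrow> scattered_part \<G> D \<subseteq> scattered_part \<G>' D"
proof
  fix d assume "\<G> \<subseteq> \<G>'" "d \<in> scattered_part \<G> D"
  from this(2) show "d \<in> scattered_part \<G>' D"
    by induction (use \<open>\<G> \<subseteq> \<G>'\<close> cylinders_mono in \<open>blast intro: scattered_part.intros\<close>)
qed

text \<open>Each step of the derivation uses one basic set, with finite support, and branches over
  points of the countable set \<open>D\<close>; a countable union collects the supports.\<close>

lemma scattered_part_countable_support: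
  assumes "countable D" "d \<in> scattered_part (f ` J) D"
  obtains K where "countable K" "K \<subseteq> J" "d \<in> scattered_part (f ` K) D"
proof -
  have "\<exists>K. countable K \<and> K \<subseteq> J \<and> d \<in> scattered_part (f ` K) D"
    using assms(2)
  proof induction
    case (1 d B)
    obtain K0 where K0: "finite K0" "K0 \<subseteq> J" "B \<in> cylinders (f ` K0)"
      using cylinder_finite_support [OF 1(2)] by blast
    have "\<forall>e\<in>B \<inter> D - {d}. \<exists>K. countable K \<and> K \<subseteq> J \<and> e \<in> scattered_part (f ` K) D"
      using 1(5) by auto
    then obtain k where k: "\<And>e. e \<in> B \<inter> D - {d} \<Longrightarrow>
        countable (k e) \<and> k e \<subseteq> J \<and> e \<in> scattered_part (f ` k e) D"
      by metis
    let ?K = "K0 \<union> (\<Union>e\<in>B \<inter> D - {d}. k e)"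
    have "countable ?K"
      using k assms(1) K0(1) by (intro countable_Un countable_UN) (auto simp: countable_finite)
    moreover have "?K \<subseteq> J" using k K0(2) by blast
    moreover have "d \<in> scattered_part (f ` ?K) D"
    proof (rule scattered_part.intros)
      show "B \<in> cylinders (f ` ?K)" using K0(3) cylinders_mono [of "f ` K0" "f ` ?K"] by blast
      show "e \<in> scattered_part (f ` ?K) D" if "e \<in> B" "e \<in> D" "e \<noteq> d" for e
        using k [of e] scattered_part_mono [of "f ` k e" "f ` ?K" D] that by blast
    qed (use 1 in auto)
    ultimately show ?case by blast
  qed
  then show ?thesis using that by blast
qed

text \<open>An isolated point of the unranked remainder would itself qualify for a level.\<close>

lemma scattered_subset_scattered_part:
  assumes "\<And>T. T \<subseteq> D \<Longrightarrow> T \<noteq> {} \<Longrightarrow> \<exists>x\<in>T. \<exists>B\<in>cylinders \<G>. x \<in> B \<and> B \<inter> T \<subseteq> {x}"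
  shows "D \<subseteq> scattered_part \<G> D"
proof (rule ccontr)
  assume "\<not> D \<subseteq> scattered_part \<G> D"
  then obtain x B where x: "x \<in> D - scattered_part \<G> D" "B \<in> cylinders \<G>" "x \<in> B"
      "B \<inter> (D - scattered_part \<G> D) \<subseteq> {x}"
    using assms [of "D - scattered_part \<G> D"] by blast
  then have "x \<in> scattered_part \<G> D"
    by (intro scattered_part.intros [of x D B]) auto
  then show False using x by blast
qed

section \<open>Stages, tasks and the promises made at each stage\<close>

text \<open>The stages have order type \<omega>1, and \<open>U\<close> is a free ultrafilter. Every
  task recurs beyond each stage, so it can wait until all the generators and points it mentions are
  present.\<close>

locale staged_generators =
  fixes U :: "nat set set"
    and task :: "'i::wellorder \<Rightarrow> (nat \<Rightarrow> nat set) \<times> (nat \<Rightarrow> nat + 'i) \<times> (nat + 'i)"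
  assumes ultra_infinite: "\<And>A. A \<in> U \<Longrightarrow> infinite A"
    and ultra_Int: "\<And>A B. A \<inter> B \<in> U \<longleftrightarrow> A \<in> U \<and> B \<in> U"
    and ultra_Compl: "\<And>A. - A \<in> U \<longleftrightarrow> A \<notin> U"
    and countable_below: "\<And>\<delta> :: 'i. countable {..<\<delta>}"
    and uncountable_stages: "uncountable (UNIV :: 'i set)"
    and task_cofinal: "\<And>t \<beta>. \<exists>\<delta>>\<beta>. task \<delta> = t"
begin

text \<open>
  A task \<open>(W, d, y)\<close> asks to make the new point an accumulation point of the blocks \<open>W n\<close> and to
  separate the range of \<open>d\<close> from \<open>y\<close>.
\<close>

definition block :: "'i \<Rightarrow> nat \<Rightarrow> nat set" where
  "block \<gamma> = fst (task \<gamma>)"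

text \<open>An empty block still yields some natural, so every new point becomes an ultrafilter
  limit of naturals whatever its task is.\<close>

definition pick :: "'i \<Rightarrow> nat \<Rightarrow> nat" where
  "pick \<gamma> n = (LEAST m. m \<in> block \<gamma> n)"

definition target :: "'i \<Rightarrow> (nat + 'i) set" where
  "target \<gamma> = range (fst (snd (task \<gamma>)))"

definition excluded :: "'i \<Rightarrow> nat + 'i" where
  "excluded \<gamma> = snd (snd (task \<gamma>))"

text \<open>
  The generators of the stages before \<open>\<gamma>\<close> see the point \<open>Inr \<gamma>\<close> as the \<open>U\<close>-limit of the picked elements.
\<close>

definition tracks :: "'i \<Rightarrow> (nat + 'i) set \<Rightarrow> bool" where
  "tracks \<gamma> g \<longleftrightarrow> (Inr \<gamma> \<in> g \<longleftrightarrow> {n. Inl (pick \<gamma> n) \<in> g} \<in> U)"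

text \<open>The values at the new points are those forced by \<open>tracks\<close>, so all points
  track the bits from the start.\<close>

definition bit_gen :: "nat \<Rightarrow> (nat + 'i) set" where
  "bit_gen j = Inl ` bit_set j \<union> Inr ` {\<gamma>. {n. pick \<gamma> n \<in> bit_set j} \<in> U}"

definition stage :: "('i \<Rightarrow> (nat + 'i) set) \<Rightarrow> 'i \<Rightarrow> (nat + 'i) set set" where
  "stage G \<delta> = range bit_gen \<union> G ` {..<\<delta>}"

text \<open>Promising every tail makes each neighbourhood of the new point meet blocks of
  arbitrarily large index.\<close>

definition tail :: "'i \<Rightarrow> nat \<Rightarrow> nat set" where
  "tail \<gamma> k = (\<Union>n\<in>{k..}. block \<gamma> n)"

text \<open>The condition under which the tail promises are already true when they are made.\<close>

definition active :: "('i \<Rightarrow> (nat + 'i) set) \<Rightarrow> 'i \<Rightarrow> bool" where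
  "active G \<gamma> \<longleftrightarrow> (\<forall>n. block \<gamma> n \<noteq> {} \<and> (\<forall>w\<in>block \<gamma> n. clusters (stage G \<gamma>) (Inl w) (block \<gamma> n)))"

text \<open>The first family keeps every fiber crowded; the second keeps the complement of every
  fiber dense at the naturals, so that fibers can become nowhere dense.\<close>

definition base_promises :: "((nat + 'i) \<times> nat set) set" where
  "base_promises = (\<lambda>a. (Inl a, fiber (fst (prod_decode a)))) ` UNIV \<union> (\<lambda>(a, i). (Inl a, - fiber i)) ` UNIV"

definition new_promises :: "('i \<Rightarrow> (nat + 'i) set) \<Rightarrow> 'i \<Rightarrow> ((nat + 'i) \<times> nat set) set" where
  "new_promises G \<gamma> = (\<lambda>i. (Inr \<gamma>, - fiber i)) ` UNIV \<union> (if active G \<gamma> then (\<lambda>k. (Inr \<gamma>, tail \<gamma> k)) ` UNIV else {})"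

definition promises :: "('i \<Rightarrow> (nat + 'i) set) \<Rightarrow> 'i \<Rightarrow> ((nat + 'i) \<times> nat set) set" where
  "promises G \<delta> = base_promises \<union> (\<Union>\<gamma>\<le>\<delta>. new_promises G \<gamma>)"

text \<open>The membership of points that are not early is already dictated by \<^const>\<open>tracks\<close>.\<close>

definition early :: "'i \<Rightarrow> (nat + 'i) set" where
  "early \<delta> = range Inl \<union> Inr ` {..\<delta>}"

text \<open>Separation is demanded only among points up to stage \<open>\<delta>\<close>, where
  values are still free, and only if earlier generators already witness scatteredness.\<close>

definition admissible :: "('i \<Rightarrow> (nat + 'i) set) \<Rightarrow> 'i \<Rightarrow> (nat + 'i) set \<Rightarrow> bool" where
  "admissible G \<delta> g \<longleftrightarrow>
    (\<forall>(x, A)\<in>promises G \<delta>. crowds (insert g (stage G \<delta>)) x A) \<and>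
    (target \<delta> \<subseteq> early \<delta> \<and> excluded \<delta> \<in> early \<delta> - target \<delta> \<and> target \<delta> \<subseteq> scattered_part (stage G \<delta>) (target \<delta>)
      \<longrightarrow> target \<delta> \<subseteq> g \<and> excluded \<delta> \<notin> g) \<and>
    (\<forall>\<gamma>>\<delta>. tracks \<gamma> g)"

lemma stage_cong: "(\<And>\<xi>. \<xi> < \<delta> \<Longrightarrow> G \<xi> = G' \<xi>) \<Longrightarrow> stage G \<delta> = stage G' \<delta>"
  by (auto simp: stage_def)

text \<open>The requirement at \<open>\<delta>\<close> depends only on earlier generators, as the
  well-founded choice of \<open>G\<close> needs.\<close>

lemma admissible_cong:
  assumes "\<And>\<xi>. \<xi> < \<delta> \<Longrightarrow> G \<xi> = G' \<xi>"
  shows "admissible G \<delta> g = admissible G' \<delta> g"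
proof -
  have st: "stage G \<gamma> = stage G' \<gamma>" if "\<gamma> \<le> \<delta>" for \<gamma>
    using assms that by (intro stage_cong) auto
  then have "promises G \<delta> = promises G' \<delta>"
    by (simp add: promises_def new_promises_def active_def)
  then show ?thesis using st by (simp add: admissible_def)
qed

lemma ultra_UNIV: "UNIV \<in> U"
  using ultra_Compl [of UNIV] ultra_infinite [of "{}"] by auto

lemma ultra_INT: "finite I \<Longrightarrow> (\<Inter>i\<in>I. T i) \<in> U \<longleftrightarrow> (\<forall>i\<in>I. T i \<in> U)"
  by (induction rule: finite_induct) (auto simp: ultra_UNIV ultra_Int)

text \<open>An ultrafilter commutes with finite Boolean operations, so the limit rule passes from
  generators to basic sets.\<close>

lemma tracks_cylinder:
  assumes "\<And>g. g \<in> \<G> \<Longrightarrow> tracks \<gamma> g" "B \<in> cylinders \<G>"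
  shows "tracks \<gamma> B"
proof -
  obtain F K where FK: "finite F" "finite K" "F \<subseteq> \<G>" "K \<subseteq> \<G>" "B = \<Inter>F - \<Union>K"
    using assms(2) by (auto simp: cylinders_def)
  let ?T = "\<lambda>g. {n. Inl (pick \<gamma> n) \<in> g}"
  have "{n. Inl (pick \<gamma> n) \<in> B} = (\<Inter>g\<in>F. ?T g) \<inter> (\<Inter>g\<in>K. - ?T g)"
    using FK by auto
  then have "{n. Inl (pick \<gamma> n) \<in> B} \<in> U \<longleftrightarrow> (\<forall>g\<in>F. ?T g \<in> U) \<and> (\<forall>g\<in>K. ?T g \<notin> U)"
    using FK by (simp only: ultra_Int ultra_INT ultra_Compl)
  also have "\<dots> \<longleftrightarrow> (\<forall>g\<in>F. Inr \<gamma> \<in> g) \<and> (\<forall>g\<in>K. Inr \<gamma> \<notin> g)"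
    using assms(1) FK unfolding tracks_def by blast
  finally show ?thesis using FK by (auto simp: tracks_def)
qed

lemma Inl_in_bit_gen [simp]: "Inl n \<in> bit_gen j \<longleftrightarrow> n \<in> bit_set j"
  by (auto simp: bit_gen_def)

lemma tracks_bit_gen: "tracks \<gamma> (bit_gen j)"
  by (auto simp: tracks_def) (auto simp: bit_gen_def)

lemma fiber_homogeneous:
  assumes "B \<in> cylinders (range bit_gen)" "m \<in> fiber i" "n \<in> fiber i"
  shows "Inl m \<in> B \<longleftrightarrow> Inl n \<in> B"
  using assms(2,3) by (intro cylinder_cong [OF assms(1)]) (auto simp: fiber_def bit_set_def)

text \<open>With bits alone a basic set contains a whole fiber or misses it, and a nonempty trace on
  one fiber brings in a second fiber that agrees on the finitely many bits used.\<close>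

lemma base_promise_initial:
  assumes "(x, A) \<in> base_promises"
  shows "crowds (range bit_gen) x A"
proof -
  have *: "clusters (range bit_gen) (Inl a) (fiber (fst (prod_decode a)))" for a
    unfolding clusters_def
  proof (intro ballI impI)
    fix B assume B: "B \<in> cylinders (range bit_gen)" "Inl a \<in> B"
    have "a \<in> fiber (fst (prod_decode a))" by (simp add: fiber_def)
    then have "fiber (fst (prod_decode a)) \<subseteq> {n \<in> fiber (fst (prod_decode a)). Inl n \<in> B}"
      using fiber_homogeneous [OF B(1)] B(2) by blast
    then show "infinite {n \<in> fiber (fst (prod_decode a)). Inl n \<in> B}"
      using infinite_fiber infinite_super by blast
  qed
  have **: "clusters (range bit_gen) (Inl a) (- fiber i)" for a i
    unfolding clusters_def
  proof (intro ballI impI)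
    fix B assume B: "B \<in> cylinders (range bit_gen)" "Inl a \<in> B"
    then obtain J where J: "finite J" "B \<in> cylinders (bit_gen ` J)"
      using cylinder_finite_support by metis
    obtain i' where i': "i' \<noteq> i"
      "\<And>j m n. j \<in> J \<Longrightarrow> m \<in> fiber (fst (prod_decode a)) \<Longrightarrow> n \<in> fiber i' \<Longrightarrow> m \<in> bit_set j \<longleftrightarrow> n \<in> bit_set j"
      using other_fiber_same_bits [OF J(1)] by metis
    have "Inl a \<in> B \<longleftrightarrow> Inl n \<in> B" if "n \<in> fiber i'" for n
      using i'(2) [of _ a n] that by (intro cylinder_cong [OF J(2)]) (auto simp: fiber_def)
    then have "fiber i' \<subseteq> {n \<in> - fiber i. Inl n \<in> B}"
      using B(2) i'(1) by (auto simp: fiber_def)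
    then show "infinite {n \<in> - fiber i. Inl n \<in> B}"
      using infinite_fiber infinite_super by blast
  qed
  have fib: "clusters (range bit_gen) (Inl b) (fiber i)" if "b \<in> fiber i" for b i
    using * [of b] that by (simp add: fiber_def)
  from assms consider a i where "a \<in> fiber i" "x = Inl a" "A = fiber i"
    | a i where "x = Inl a" "A = - fiber i"
    by (auto simp: base_promises_def fiber_def)
  then show ?thesis
    by cases (auto simp: crowds_def fib **)
qed

text \<open>Puts bits and stage generators under one index, so that
  \<open>cylinder_finite_support\<close> covers both.\<close>

lemma generators_indexed:
  "range bit_gen \<union> G ` K = case_sum bit_gen G ` (range Inl \<union> Inr ` K)"
  by (simp add: image_Un image_image)

text \<open>A basic set uses finitely many generators, so admissibility at the latest stage involved
  keeps the promise. An initial segment for \<open>K\<close> handles all stages including limits,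
  and \<open>UNIV\<close> handles the final space.\<close>

lemma promise_preserved:
  assumes adm: "\<And>\<xi>. \<xi> \<in> K \<Longrightarrow> admissible G \<xi> (G \<xi>)"
    and "\<gamma> \<in> K" and promise: "(x, A) \<in> promises G \<gamma>"
  shows "crowds (range bit_gen \<union> G ` K) x A"
  unfolding crowds_def clusters_def
proof (intro ballI impI)
  fix y B assume y: "y \<in> insert x (Inl ` A)" and B: "B \<in> cylinders (range bit_gen \<union> G ` K)" "y \<in> B"
  then obtain J where J: "finite J" "J \<subseteq> range Inl \<union> Inr ` K"
    "B \<in> cylinders (case_sum bit_gen G ` J)"
    unfolding generators_indexed using cylinder_finite_support by metis
  \<comment> \<open>Including \<open>\<gamma>\<close> gives a maximum even if only bits occur, and
    ensures that the promise has been made by stage \<open>m\<close>.\<close>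
  define m where "m = Max (insert \<gamma> (Inr -` J))"
  have fin: "finite (Inr -` J)" using J(1) by (simp add: finite_vimageI)
  then have "m \<in> insert \<gamma> (Inr -` J)" unfolding m_def by (intro Max_in) auto
  then have m: "m \<in> K" using J(2) \<open>\<gamma> \<in> K\<close> by auto
  have le: "\<xi> \<le> m" if "\<xi> \<in> insert \<gamma> (Inr -` J)" for \<xi>
    unfolding m_def using fin that by (intro Max_ge) auto
  have "case_sum bit_gen G ` J \<subseteq> insert (G m) (stage G m)"
  proof (intro image_subsetI)
    fix s assume "s \<in> J"
    then show "case_sum bit_gen G s \<in> insert (G m) (stage G m)"
      using le by (cases s) (auto simp: stage_def le_less)
  qed
  then have "B \<in> cylinders (insert (G m) (stage G m))" using J(3) cylinders_mono by blast
  moreover have "(x, A) \<in> promises G m"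
    using promise le [of \<gamma>] by (force simp: promises_def)
  then have "crowds (insert (G m) (stage G m)) x A"
    using adm [OF m] by (auto simp: admissible_def)
  ultimately show "infinite {n \<in> A. Inl n \<in> B}" using y B(2) by (auto simp: crowds_def clusters_def)
qed

text \<open>Old promises survive by \<open>promise_preserved\<close>. Those made at
  \<open>\<delta>\<close> hold because earlier generators see \<open>Inr \<delta>\<close> as a limit
  of picked naturals, which already cluster at the promised set.\<close>

lemma promises_hold:
  assumes adm: "\<And>\<xi>. \<xi> < \<delta> \<Longrightarrow> admissible G \<xi> (G \<xi>)" and promise: "(x, A) \<in> promises G \<delta>"
  shows "crowds (stage G \<delta>) x A"
proof -
  have base: "crowds (stage G \<delta>) x A" if "(x, A) \<in> base_promises" for x A
  \<comment> \<open>At the least stage only the bits exist and no earlier admissible generator can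
    be invoked.\<close>
  proof (cases "{..<\<delta>} = {}")
    case True
    then show ?thesis using base_promise_initial [OF that] by (simp add: stage_def)
  next
    case False
    then obtain \<gamma> where "\<gamma> < \<delta>" by auto
    then show ?thesis unfolding stage_def
      using adm that by (intro promise_preserved [of _ _ \<gamma>]) (auto simp: promises_def)
  qed
  have trk: "tracks \<delta> g" if "g \<in> stage G \<delta>" for g
    using that adm tracks_bit_gen by (auto simp: stage_def admissible_def)
  \<comment> \<open>Members of \<open>U\<close> are infinite, so the index of the pick can be
    arbitrarily large, as the tail promises require.\<close>
  have resp: "\<exists>n\<ge>k. Inl (pick \<delta> n) \<in> B" if "B \<in> cylinders (stage G \<delta>)" "Inr \<delta> \<in> B" for B k
  proof -
    have "infinite {n. Inl (pick \<delta> n) \<in> B}"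
      using tracks_cylinder [OF trk that(1)] that(2) ultra_infinite by (simp add: tracks_def)
    then show ?thesis by (auto simp: infinite_nat_iff_unbounded_le)
  qed
  have "(x, A) \<in> base_promises \<or> (\<exists>\<gamma><\<delta>. (x, A) \<in> new_promises G \<gamma>) \<or> (x, A) \<in> new_promises G \<delta>"
    using promise by (auto simp: promises_def le_less)
  then consider "(x, A) \<in> base_promises" | \<gamma> where "\<gamma> < \<delta>" "(x, A) \<in> new_promises G \<gamma>"
    | i where "x = Inr \<delta>" "A = - fiber i" | k where "active G \<delta>" "x = Inr \<delta>" "A = tail \<delta> k"
    unfolding new_promises_def [of G \<delta>] by (auto split: if_splits)
  then show ?thesis
  proof cases
    case 1
    then show ?thesis by (rule base)
  next
    case 2
    then show ?thesis unfolding stage_def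
      using adm by (intro promise_preserved [of _ _ \<gamma>]) (auto simp: promises_def)
  next
    case 3
    have cl: "clusters (stage G \<delta>) (Inl a) (- fiber i)" for a
    proof -
      have "(Inl a, - fiber i) \<in> base_promises" by (force simp: base_promises_def)
      then show ?thesis by (rule crowds_clusters [OF base])
    qed
    have "clusters (stage G \<delta>) (Inr \<delta>) (- fiber i)"
      unfolding clusters_def using resp cl clustersD by blast
    then show ?thesis using cl 3 by (auto simp: crowds_def)
  next
    case 4
    have cl: "infinite {n \<in> tail \<delta> k. Inl n \<in> B}"
      if "B \<in> cylinders (stage G \<delta>)" "w \<in> block \<delta> n" "Inl w \<in> B" "k \<le> n" for w n B
    proof -
      have "infinite {n' \<in> block \<delta> n. Inl n' \<in> B}"
        using 4(1) that by (auto simp: active_def clusters_def)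
      then show ?thesis
        by (rule infinite_super [rotated]) (use that in \<open>auto simp: tail_def\<close>)
    qed
    have pick: "pick \<delta> n \<in> block \<delta> n" for n
      using 4(1) unfolding pick_def active_def by (metis LeastI ex_in_conv)
    have "clusters (stage G \<delta>) (Inr \<delta>) (tail \<delta> k)"
      unfolding clusters_def using resp cl pick by blast
    moreover have "clusters (stage G \<delta>) (Inl w) (tail \<delta> k)" if "w \<in> tail \<delta> k" for w
      unfolding clusters_def using cl that by (auto simp: tail_def)
    ultimately show ?thesis using 4 by (auto simp: crowds_def)
  qed
qed

lemma countable_stage: "countable (stage G \<delta>)"
  using countable_below by (simp add: stage_def)

lemma countable_atMost_stage: "countable {..\<delta> :: 'i}"
  using countable_below [of \<delta>] by (simp flip: ivl_disj_un_singleton(2))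

lemma countable_promises: "countable (promises G \<delta>)"
  using countable_atMost_stage unfolding promises_def base_promises_def new_promises_def
  by (intro countable_Un countable_UN) auto

text \<open>Generic splitting fixes the trace on the naturals and secures the promises. New points
  up to \<open>\<delta>\<close> then follow the separation task, and later ones follow the
  ultrafilter.\<close>

lemma admissible_extension:
  assumes adm: "\<And>\<xi>. \<xi> < \<delta> \<Longrightarrow> admissible G \<xi> (G \<xi>)"
  shows "\<exists>g. admissible G \<delta> g"
proof -
  let ?good = "target \<delta> \<subseteq> early \<delta> \<and> excluded \<delta> \<in> early \<delta> - target \<delta> \<and>
    target \<delta> \<subseteq> scattered_part (stage G \<delta>) (target \<delta>)"
  \<comment> \<open>A task whose preconditions fail is replaced by the empty target, which is
    trivially scattered.\<close>
  define D where "D = (if ?good then target \<delta> else {})"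
  have D: "D \<subseteq> scattered_part (stage G \<delta>) D" "D \<subseteq> early \<delta>" by (auto simp: D_def)
  obtain S where S: "\<And>(g :: (nat + 'i) set) x A.
      (\<And>n. Inl n \<in> g \<longleftrightarrow> Inl n \<in> D \<or> n \<in> S \<and> Inl n \<noteq> excluded \<delta>)
      \<Longrightarrow> (x, A) \<in> promises G \<delta> \<Longrightarrow> crowds (insert g (stage G \<delta>)) x A"
    using generic_extension [OF countable_stage countable_promises promises_hold [OF adm] D(1)] by metis
  define N where "N = {n. Inl n \<in> D \<or> n \<in> S \<and> Inl n \<noteq> excluded \<delta>}"
  define g where "g = Inl ` N \<union> (D \<inter> Inr ` {..\<delta>}) \<union> Inr ` {\<gamma>. \<gamma> > \<delta> \<and> {n. pick \<gamma> n \<in> N} \<in> U}"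
  have Inl_g: "Inl n \<in> g \<longleftrightarrow> n \<in> N" for n by (auto simp: g_def)
  have "crowds (insert g (stage G \<delta>)) x A" if "(x, A) \<in> promises G \<delta>" for x A
    using S [of g] Inl_g that by (auto simp: N_def)
  moreover have "D \<subseteq> g" using D(2) by (auto simp: g_def N_def early_def)
  moreover have "excluded \<delta> \<notin> g" if ?good
    using that by (auto simp: g_def N_def early_def D_def)
  moreover have "tracks \<gamma> g" if "\<gamma> > \<delta>" for \<gamma>
    using that Inl_g by (auto simp: tracks_def) (auto simp: g_def)
  ultimately show ?thesis by (intro exI [of _ g]) (auto simp: admissible_def D_def)
qed

lemma admissible_generators_exist: "\<exists>G. \<forall>\<delta>. admissible G \<delta> (G \<delta>)"
  using dependent_wellorder_choice [of admissible, OF admissible_cong admissible_extension] .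

end

section \<open>The resulting topology\<close>

locale staged_topology = staged_generators +
  fixes G
  assumes admissible: "\<And>\<delta>. admissible G \<delta> (G \<delta>)"
begin

definition gens :: "(nat + 'a) set set" where
  "gens = range bit_gen \<union> range G"

abbreviation limit_space :: "(nat + 'a) topology" where
  "limit_space \<equiv> cylinder_topology gens"

lemma promise_in_space: "(x, A) \<in> promises G \<gamma> \<Longrightarrow> crowds gens x A"
  unfolding gens_def using admissible by (intro promise_preserved [of UNIV]) auto

text \<open>Naturals receive this promise at the outset, and a new point receives it at its own
  stage.\<close>

lemma clusters_Compl_fiber: "clusters gens x (- fiber i)"
proof -
  have "\<exists>\<gamma>. (x, - fiber i) \<in> promises G \<gamma>"
    by (cases x) (force simp: promises_def base_promises_def new_promises_def)+
  then show ?thesis using promise_in_space crowds_clusters by blast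
qed

lemma cylinder_meets_naturals:
  assumes "B \<in> cylinders gens" "B \<noteq> {}"
  obtains n where "Inl n \<in> B" "n \<notin> fiber i"
proof -
  obtain x where "x \<in> B" using assms(2) by blast
  then have "infinite {n \<in> - fiber i. Inl n \<in> B}"
    using assms(1) clusters_Compl_fiber clustersD by blast
  then have "{n \<in> - fiber i. Inl n \<in> B} \<noteq> {}" by (metis finite.emptyI)
  then show ?thesis using that by blast
qed

lemma fiber_promise: "a \<in> fiber i \<Longrightarrow> (Inl a, fiber i) \<in> promises H \<gamma>"
  by (auto simp: promises_def base_promises_def fiber_def)

lemma clusters_fiber: "a \<in> fiber i \<Longrightarrow> clusters gens (Inl a) (fiber i)"
  using promise_in_space [OF fiber_promise] crowds_clusters by blast

text \<open>An unbounded countable set would make the stages a countable union of countable initial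
  segments.\<close>

lemma stages_bounded:
  fixes S :: "'a set"
  assumes "countable S"
  obtains b where "\<And>s. s \<in> S \<Longrightarrow> s < b"
proof (rule ccontr)
  assume "\<not> thesis"
  then have "UNIV = (\<Union>s\<in>S. {..s})" using that by (auto simp: not_less) (metis not_less)
  moreover have "countable (\<Union>s\<in>S. {..s})" using assms countable_atMost_stage by blast
  ultimately show False using uncountable_stages by simp
qed

lemma countable_Inr_vimage: "countable K \<Longrightarrow> countable (Inr -` K)"
  by (rule countable_image_inj_on [of Inr]) (auto intro: countable_subset [of _ K])

text \<open>The generators witnessing scatteredness and all the points involved appear before a
  common stage \<open>b\<close>. The separation task recurs beyond \<open>b\<close>, and the
  generator of that stage is the required one.\<close>

lemma scattered_separated:
  assumes D: "countable D" "D \<noteq> {}" "D \<subseteq> scattered_part gens D" and "x \<notin> D"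
  obtains g where "g \<in> gens" "D \<subseteq> g" "x \<notin> g"
proof -
  have "\<exists>K. countable K \<and> d \<in> scattered_part (case_sum bit_gen G ` K) D" if "d \<in> D" for d
    using D(3) that scattered_part_countable_support [OF D(1), of d "case_sum bit_gen G" "range Inl \<union> Inr ` UNIV"]
    unfolding gens_def generators_indexed by blast
  then obtain k where k: "\<And>d. d \<in> D \<Longrightarrow> countable (k d)"
    "\<And>d. d \<in> D \<Longrightarrow> d \<in> scattered_part (case_sum bit_gen G ` k d) D" by metis
  let ?K = "\<Union>d\<in>D. k d"
  have "countable ?K" using k(1) D(1) by blast
  then have "countable (Inr -` ?K \<union> Inr -` insert x D)"
    using D(1) by (intro countable_Un countable_Inr_vimage) auto
  then obtain b where b: "\<And>\<xi>. Inr \<xi> \<in> ?K \<Longrightarrow> \<xi> < b" "\<And>\<xi>. Inr \<xi> \<in> insert x D \<Longrightarrow> \<xi> < b"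
    using stages_bounded [of "Inr -` ?K \<union> Inr -` insert x D"] by (metis Un_iff vimageI)
  \<comment> \<open>Only separation is wanted here, so the blocks are taken empty.\<close>
  obtain \<delta> where \<delta>: "b < \<delta>" "task \<delta> = (\<lambda>_. {}, from_nat_into D, x)" using task_cofinal by blast
  have target: "target \<delta> = D" "excluded \<delta> = x"
    using \<delta>(2) D(1,2) by (simp_all add: target_def excluded_def)
  have "y \<in> early \<delta>" if "y \<in> insert x D" for y
    using b(2) that \<delta>(1) by (cases y) (force simp: early_def)+
  moreover have "D \<subseteq> scattered_part (stage G \<delta>) D"
  proof
    fix d assume d: "d \<in> D"
    have "case_sum bit_gen G s \<in> stage G \<delta>" if "s \<in> k d" for s
    proof (cases s)
      case (Inr \<xi>)
      then have "\<xi> < \<delta>" using b(1) [of \<xi>] that d \<delta>(1) by force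
      then show ?thesis using Inr by (simp add: stage_def)
    qed (simp add: stage_def)
    then have "case_sum bit_gen G ` k d \<subseteq> stage G \<delta>" by blast
    then show "d \<in> scattered_part (stage G \<delta>) D" using k(2) [OF d] scattered_part_mono by blast
  qed
  ultimately have "D \<subseteq> G \<delta>" "x \<notin> G \<delta>"
    using admissible [of \<delta>] \<open>x \<notin> D\<close> unfolding admissible_def target by blast+
  then show ?thesis using that [of "G \<delta>"] by (auto simp: gens_def)
qed

lemma limit_space_crowded: "crowded_space limit_space"
  unfolding crowded_space_def
proof (intro ballI notI)
  fix x assume "openin limit_space {x}"
  then have "{x} \<in> cylinders gens"
    by (auto simp: openin_cylinder_topology) (metis empty_iff subset_singletonD)
  then have "infinite {n \<in> - fiber 0. Inl n \<in> {x}}"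
    using clusters_Compl_fiber clustersD by blast
  moreover have "{n \<in> - fiber 0. Inl n \<in> {x}} \<subseteq> {projl x}" by auto
  ultimately show False using finite_subset by blast
qed

lemma limit_space_Hausdorff: "Hausdorff_space limit_space"
  unfolding Hausdorff_space_def
proof (intro allI impI)
  fix x y assume "x \<in> topspace limit_space \<and> y \<in> topspace limit_space \<and> x \<noteq> y"
  \<comment> \<open>A singleton is scattered, so separation of scattered sets from points includes
    separation of points.\<close>
  moreover have "{x} \<subseteq> scattered_part gens {x}"
    using scattered_part.intros [of x "{x}" UNIV gens] UNIV_in_cylinders by blast
  ultimately obtain g where g: "g \<in> gens" "x \<in> g" "y \<notin> g"
    using scattered_separated [of "{x}" y] by auto
  then show "\<exists>V W. openin limit_space V \<and> openin limit_space W \<and> x \<in> V \<and> y \<in> W \<and> disjnt V W"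
    using openin_cylinder [OF generator_in_cylinders] openin_cylinder [OF Compl_generator_in_cylinders]
    by (intro exI [of _ g] exI [of _ "- g"]) (auto simp: disjnt_def)
qed

section \<open>Failure of selection by scattered sets\<close>

text \<open>The union of the selected sets, without the accumulation point \<open>x\<close>, is
  still scattered, so some generator contains it and misses \<open>x\<close>. The complement of that
  generator is a neighbourhood of \<open>x\<close> meeting at most one \<open>A n\<close>.\<close>

lemma not_Scat_selectively_pseudocompact: "\<not> selectively_pseudocompact limit_space (Scat_omega limit_space)"
proof
  assume sp: "selectively_pseudocompact limit_space (Scat_omega limit_space)"
  \<comment> \<open>\<open>V n\<close> collects the points whose least bit is
    \<open>n\<close>.\<close>
  define V where "V n = bit_gen n - \<Union>(bit_gen ` {..<n})" for n
  have "V n \<in> cylinders gens" for n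
    using cylindersI [of "{bit_gen n}" "bit_gen ` {..<n}" gens] by (auto simp: V_def gens_def)
  then have V_open: "openin limit_space (V n)" for n by (rule openin_cylinder)
  have V_ne: "V n \<noteq> {}" for n
  proof -
    \<comment> \<open>The witness has \<open>n\<close> as its only bit.\<close>
    have "Inl (prod_encode (set_encode {n}, 0)) \<in> V n"
      by (auto simp: V_def bit_set_def simp del: set_encode_insert)
    then show ?thesis by blast
  qed
  have V_disj: "V m \<inter> V n = {}" if "m \<noteq> n" for m n
    using that by (cases m n rule: linorder_cases) (auto simp: V_def)
  obtain A x where A: "\<And>n. A n \<in> Scat_omega limit_space" "\<And>n. A n \<subseteq> V n"
      and x: "family_accumulation_point limit_space A x"
    using sp V_open V_ne V_disj unfolding selectively_pseudocompact_def by metis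
  define D where "D = (\<Union>n. A n) - {x}"
  have "countable D" using A(1) by (auto simp: D_def Scat_omega_def)
  moreover have "infinite (A 0 - {x})" using A(1) [of 0] by (simp add: Scat_omega_def)
  then have "D \<noteq> {}" unfolding D_def by (metis Diff_mono UNIV_I UN_upper finite.emptyI order_refl subset_empty)
  moreover have "D \<subseteq> scattered_part gens D"
  proof (rule scattered_subset_scattered_part)
    fix T assume T: "T \<subseteq> D" "T \<noteq> {}"
    then obtain n where n: "T \<inter> A n \<noteq> {}" unfolding D_def by blast
    have "scattered_in limit_space (A n)" using A(1) by (simp add: Scat_omega_def)
    then obtain y W where y: "y \<in> T \<inter> A n" "openin limit_space W" "W \<inter> (T \<inter> A n) = {y}"
      unfolding scattered_in_def using n by (metis inf_le2)
    then have "openin limit_space (W \<inter> V n)" "y \<in> W \<inter> V n" using V_open A(2) by auto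
    then obtain B where B: "B \<in> cylinders gens" "y \<in> B" "B \<subseteq> W \<inter> V n"
      by (meson openin_cylinder_topology)
    \<comment> \<open>Disjointness of the \<open>V m\<close> turns isolation within
      \<open>A n\<close> into isolation within the whole union.\<close>
    have "V n \<inter> T \<subseteq> A n"
    proof
      fix z assume z: "z \<in> V n \<inter> T"
      then obtain m where m: "z \<in> A m" using T(1) by (auto simp: D_def)
      then have "z \<in> V m \<inter> V n" using A(2) z by auto
      then have "m = n" using V_disj [of m n] by auto
      then show "z \<in> A n" using m by simp
    qed
    then have "B \<inter> T \<subseteq> {y}" using B(3) y(3) by blast
    then show "\<exists>x\<in>T. \<exists>B\<in>cylinders gens. x \<in> B \<and> B \<inter> T \<subseteq> {x}" using y(1) B by blast
  qed
  ultimately obtain g where g: "g \<in> gens" "D \<subseteq> g" "x \<notin> g"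
    using scattered_separated [of D x] by (auto simp: D_def)
  then have "infinite {n. A n \<inter> - g \<noteq> {}}"
    using x openin_cylinder [OF Compl_generator_in_cylinders]
    unfolding family_accumulation_point_def by blast
  \<comment> \<open>The only selected point that \<open>g\<close> may omit is \<open>x\<close>
    itself.\<close>
  moreover have "{n. A n \<inter> - g \<noteq> {}} \<subseteq> {n. x \<in> V n}"
    using g(2) A(2) by (auto simp: D_def)
  moreover have "finite {n. x \<in> V n}"
  proof (cases "\<exists>m. x \<in> V m")
    case True
    then obtain m where "x \<in> V m" by blast
    then have "n = m" if "x \<in> V n" for n using V_disj [of n m] that by auto
    then have "{n. x \<in> V n} \<subseteq> {m}" by auto
    then show ?thesis using finite_subset by blast
  qed auto
  ultimately show False using finite_subset by blast
qed

section \<open>Selection by nowhere dense sets\<close>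

text \<open>Every nonempty open set contains a natural outside the fiber, and a single bit separates
  that natural from the fiber.\<close>

lemma nowhere_dense_fiber: "nowhere_dense_in limit_space (Inl ` fiber i)"
  unfolding nowhere_dense_in_def
proof (rule ccontr)
  assume "limit_space interior_of (limit_space closure_of (Inl ` fiber i)) \<noteq> {}"
  then obtain V x where V: "openin limit_space V" "x \<in> V" "V \<subseteq> limit_space closure_of (Inl ` fiber i)"
    by (auto simp: interior_of_def)
  then obtain B where B: "B \<in> cylinders gens" "x \<in> B" "B \<subseteq> V"
    by (auto simp: openin_cylinder_topology)
  then obtain v where v: "Inl v \<in> B" "v \<notin> fiber i"
    using cylinder_meets_naturals [of B i] by blast
  obtain a where a: "a \<in> fiber i" using infinite_fiber by (metis finite.emptyI ex_in_conv)
  have "\<exists>C\<in>cylinders gens. Inl v \<in> C \<and> C \<inter> Inl ` fiber i = {}"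
    using distinct_fibers_separated_by_bit [OF a v(2)]
  proof cases
    case (1 j)
    then show ?thesis
      by (intro bexI [of _ "bit_gen j"] generator_in_cylinders) (auto simp: gens_def)
  next
    case (2 j)
    then show ?thesis
      by (intro bexI [of _ "- bit_gen j"] Compl_generator_in_cylinders) (auto simp: gens_def)
  qed
  then obtain C where "C \<in> cylinders gens" "Inl v \<in> C" "C \<inter> Inl ` fiber i = {}" by blast
  moreover have "Inl v \<in> limit_space closure_of (Inl ` fiber i)" using V(3) B(3) v(1) by blast
  ultimately show False
    using openin_cylinder [of C gens] unfolding in_closure_of by blast
qed

text \<open>In each \<open>V n\<close> a basic set is cut down to the fiber of one of its naturals.
  These traces \<open>W n\<close> are nowhere dense and, by the fiber promises, crowded; hence a
  late stage with blocks \<open>W\<close> is active and its point accumulates them.\<close>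

lemma Nwd_selectively_pseudocompact: "selectively_pseudocompact limit_space (Nwd_omega limit_space)"
  unfolding selectively_pseudocompact_def
proof (intro allI impI)
  fix V :: "nat \<Rightarrow> (nat + 'a) set"
  assume "(\<forall>n. openin limit_space (V n) \<and> V n \<noteq> {}) \<and> (\<forall>m n. m \<noteq> n \<longrightarrow> V m \<inter> V n = {})"
  then have "\<exists>B w. B \<in> cylinders gens \<and> B \<subseteq> V n \<and> Inl w \<in> B" for n
    using cylinder_meets_naturals [of _ 0] by (metis empty_iff ex_in_conv openin_cylinder_topology)
  then obtain B w where B: "\<And>n. B n \<in> cylinders gens" "\<And>n. B n \<subseteq> V n" and w: "\<And>n. Inl (w n) \<in> B n"
    by metis
  define F where "F n = fiber (fst (prod_decode (w n)))" for n
  define W where "W n = {m \<in> F n. Inl m \<in> B n}" for n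
  have w_W: "w n \<in> W n" for n using w by (simp add: W_def F_def fiber_def)
  have "\<exists>K. finite K \<and> B n \<in> cylinders (case_sum bit_gen G ` K)" for n
    using B(1) [of n] cylinder_finite_support [of "B n" "case_sum bit_gen G"]
    unfolding gens_def generators_indexed by metis
  then obtain K where K: "\<And>n. finite (K n)" "\<And>n. B n \<in> cylinders (case_sum bit_gen G ` K n)" by metis
  have "countable (Inr -` (\<Union>n. K n))"
    using K(1) by (intro countable_Inr_vimage countable_UN) (auto simp: countable_finite)
  then obtain b where b: "\<And>\<xi> n. Inr \<xi> \<in> K n \<Longrightarrow> \<xi> < b"
    using stages_bounded [of "Inr -` (\<Union>n. K n)"] by (metis UN_I UNIV_I vimageI)
  \<comment> \<open>The excluded point lies in the target, so this task carries no separation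
    demand.\<close>
  obtain \<delta> where \<delta>: "b < \<delta>" "task \<delta> = (W, \<lambda>_. Inl 0, Inl 0)" using task_cofinal by blast
  have block: "block \<delta> = W" using \<delta>(2) by (simp add: block_def)
  have B_stage: "B n \<in> cylinders (stage G \<delta>)" for n
  proof -
    have "case_sum bit_gen G s \<in> stage G \<delta>" if "s \<in> K n" for s
    proof (cases s)
      case (Inr \<xi>)
      then have "\<xi> < \<delta>" using b [of \<xi>] that \<delta>(1) by force
      then show ?thesis using Inr by (simp add: stage_def)
    qed (simp add: stage_def)
    then have "case_sum bit_gen G ` K n \<subseteq> stage G \<delta>" by blast
    then show ?thesis using K(2) cylinders_mono by blast
  qed
  \<comment> \<open>The family \<open>\<G>\<close> is arbitrary because the fact is applied both at
    stage \<open>\<delta>\<close> and in the final space.\<close>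
  have W_clusters: "clusters \<G> (Inl m) (W n)"
    if "clusters \<G> (Inl m) (F n)" "B n \<in> cylinders \<G>" "m \<in> W n" for \<G> m n
    unfolding clusters_def
  proof (intro ballI impI)
    fix C assume "C \<in> cylinders \<G>" "Inl m \<in> C"
    then have "infinite {k \<in> F n. Inl k \<in> B n \<inter> C}"
      using that by (intro clustersD [OF that(1)] Int_in_cylinders) (auto simp: W_def)
    then show "infinite {k \<in> W n. Inl k \<in> C}" by (simp add: W_def conj_assoc)
  qed
  have "clusters (stage G \<delta>) (Inl m) (W n)" if "m \<in> W n" for m n
  proof (rule W_clusters)
    have "m \<in> F n" using that by (simp add: W_def)
    then have "(Inl m, F n) \<in> promises G \<delta>" unfolding F_def by (rule fiber_promise)
    then show "clusters (stage G \<delta>) (Inl m) (F n)"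
      using promises_hold [OF admissible] crowds_clusters by blast
  qed (use that B_stage in auto)
  then have "active G \<delta>" using w_W by (auto simp: active_def block)
  then have tail: "clusters gens (Inr \<delta>) (tail \<delta> k)" for k
    by (intro crowds_clusters promise_in_space [of _ _ \<delta>]) (auto simp: promises_def new_promises_def)
  let ?A = "\<lambda>n. (Inl ` W n :: (nat + 'a) set)"
  have "infinite (W n)" for n
  proof -
    have "clusters gens (Inl (w n)) (W n)"
      using B(1) w_W by (intro W_clusters) (auto simp: F_def fiber_def intro!: clusters_fiber [unfolded fiber_def])
    then show ?thesis using clustersD [OF _ UNIV_in_cylinders] by fastforce
  qed
  moreover have "nowhere_dense_in limit_space (?A n)" for n
  proof -
    have "limit_space closure_of ?A n \<subseteq> limit_space closure_of (Inl ` F n)"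
      by (intro closure_of_mono) (auto simp: W_def)
    then show ?thesis
      using nowhere_dense_fiber interior_of_mono unfolding nowhere_dense_in_def F_def by blast
  qed
  ultimately have "?A n \<in> Nwd_omega limit_space" for n
    by (auto simp: Nwd_omega_def finite_image_iff)
  moreover have "?A n \<subseteq> V n" for n using B(2) by (auto simp: W_def)
  moreover have "family_accumulation_point limit_space ?A (Inr \<delta>)"
    unfolding family_accumulation_point_def
  proof (intro conjI allI impI)
    fix N assume "openin limit_space N \<and> Inr \<delta> \<in> N"
    then obtain C where C: "C \<in> cylinders gens" "Inr \<delta> \<in> C" "C \<subseteq> N"
      by (auto simp: openin_cylinder_topology)
    have "\<exists>n\<ge>k. ?A n \<inter> N \<noteq> {}" for k
    proof -
      \<comment> \<open>A point of this set lies in some block of index at least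
        \<open>k\<close>.\<close>
      have "{m \<in> tail \<delta> k. Inl m \<in> C} \<noteq> {}"
        using clustersD [OF tail C(1,2)] by (metis finite.emptyI)
      then show ?thesis using C(3) by (auto simp: tail_def block)
    qed
    then show "infinite {n. ?A n \<inter> N \<noteq> {}}" by (simp add: infinite_nat_iff_unbounded_le)
  qed simp
  ultimately show "\<exists>A. (\<forall>n. A n \<in> Nwd_omega limit_space \<and> A n \<subseteq> V n) \<and> (\<exists>x. family_accumulation_point limit_space A x)"
    by (intro exI [of _ ?A]) auto
qed

end

section \<open>Transfer to sets of sets of naturals\<close>

lemma selectively_pseudocompact_homeomorphic_image:
  assumes f: "homeomorphic_map X Y f" and \<A>: "\<And>S. S \<in> \<A> \<Longrightarrow> f ` S \<in> \<B>"
    and sub: "\<And>S. S \<in> \<A> \<Longrightarrow> S \<subseteq> topspace X"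
    and sp: "selectively_pseudocompact X \<A>"
  shows "selectively_pseudocompact Y \<B>"
  unfolding selectively_pseudocompact_def
proof (intro allI impI)
  fix V :: "nat \<Rightarrow> 'b set"
  assume V: "(\<forall>n. openin Y (V n) \<and> V n \<noteq> {}) \<and> (\<forall>m n. m \<noteq> n \<longrightarrow> V m \<inter> V n = {})"
  have cont: "continuous_map X Y f" and surj: "f ` topspace X = topspace Y"
    using f by (auto simp: homeomorphic_eq_everything_map)
  define W where "W n = {x \<in> topspace X. f x \<in> V n}" for n
  have "openin X (W n)" for n
    unfolding W_def using openin_continuous_map_preimage [OF cont] V by blast
  moreover have "W n \<noteq> {}" for n
  proof -
    obtain y where "y \<in> V n" using V by blast
    moreover from this have "y \<in> f ` topspace X" using V openin_subset surj by blast
    ultimately show ?thesis by (auto simp: W_def)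
  qed
  moreover have "W m \<inter> W n = {}" if "m \<noteq> n" for m n
    using V that by (auto simp: W_def)
  ultimately obtain A x where A: "\<And>n. A n \<in> \<A>" "\<And>n. A n \<subseteq> W n"
    and x: "family_accumulation_point X A x"
    using sp unfolding selectively_pseudocompact_def by metis
  have "family_accumulation_point Y (\<lambda>n. f ` A n) (f x)"
    unfolding family_accumulation_point_def
  proof (intro conjI allI impI)
    show "f x \<in> topspace Y" using x surj by (auto simp: family_accumulation_point_def)
    fix N assume N: "openin Y N \<and> f x \<in> N"
    have "openin X {x \<in> topspace X. f x \<in> N}"
      using openin_continuous_map_preimage [OF cont] N by blast
    then have "infinite {n. A n \<inter> {x \<in> topspace X. f x \<in> N} \<noteq> {}}"
      using x N unfolding family_accumulation_point_def by blast
    then show "infinite {n. f ` A n \<inter> N \<noteq> {}}"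
      by (rule infinite_super [rotated]) auto
  qed
  moreover have "f ` A n \<in> \<B> \<and> f ` A n \<subseteq> V n" for n
    using A \<A> by (auto simp: W_def)
  ultimately show "\<exists>A. (\<forall>n. A n \<in> \<B> \<and> A n \<subseteq> V n) \<and> (\<exists>x. family_accumulation_point Y A x)"
    by (intro exI [of _ "\<lambda>n. f ` A n"]) blast
qed

lemma Scat_omega_homeomorphic_image:
  assumes f: "homeomorphic_map X Y f" and S: "S \<in> Scat_omega X"
  shows "f ` S \<in> Scat_omega Y"
proof -
  have inj: "inj_on f (topspace X)" and "open_map X Y f" and surj: "f ` topspace X = topspace Y"
    using f by (auto simp: homeomorphic_eq_everything_map)
  have S': "S \<subseteq> topspace X" "countable S" "infinite S" "scattered_in X S"
    using S by (auto simp: Scat_omega_def)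
  have "scattered_in Y (f ` S)"
    unfolding scattered_in_def
  proof (intro allI impI)
    fix T assume T: "T \<subseteq> f ` S \<and> T \<noteq> {}"
    then obtain R where R: "R \<subseteq> S" "T = f ` R" by (auto simp: subset_image_iff)
    then have "R \<noteq> {}" using T by auto
    then have "\<exists>x\<in>R. \<exists>U. openin X U \<and> U \<inter> R = {x}"
      using S'(4) R(1) unfolding scattered_in_def by simp
    then obtain x U where x: "x \<in> R" "openin X U" "U \<inter> R = {x}" by auto
    have "f ` U \<inter> f ` R = f ` (U \<inter> R)"
      using inj_on_image_Int [OF inj openin_subset [OF x(2)], of R] R(1) S'(1) by auto
    then show "\<exists>x\<in>T. \<exists>U. openin Y U \<and> U \<inter> T = {x}"
      using x R \<open>open_map X Y f\<close> unfolding open_map_def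
      by (intro bexI [of _ "f x"] exI [of _ "f ` U"]) auto
  qed
  moreover have "f ` S \<subseteq> topspace Y" using S'(1) surj by blast
  moreover have "infinite (f ` S)" using S'(1,3) inj by (metis finite_image_iff inj_on_subset)
  ultimately show ?thesis
    using S' by (simp add: Scat_omega_def)
qed

lemma Nwd_omega_homeomorphic_image:
  assumes f: "homeomorphic_map X Y f" and S: "S \<in> Nwd_omega X"
  shows "f ` S \<in> Nwd_omega Y"
proof -
  have inj: "inj_on f (topspace X)" and surj: "f ` topspace X = topspace Y"
    using f by (auto simp: homeomorphic_eq_everything_map)
  have S': "S \<subseteq> topspace X" "countable S" "infinite S" "X interior_of (X closure_of S) = {}"
    using S by (auto simp: Nwd_omega_def nowhere_dense_in_def)
  have "Y interior_of (Y closure_of (f ` S)) = f ` (X interior_of (X closure_of S))"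
    using homeomorphic_map_closure_of [OF f S'(1)]
      homeomorphic_map_interior_of [OF f closure_of_subset_topspace] by simp
  moreover have "f ` S \<subseteq> topspace Y" using S'(1) surj by blast
  moreover have "infinite (f ` S)" using S'(1,3) inj by (metis finite_image_iff inj_on_subset)
  ultimately show ?thesis
    using S' by (simp add: Nwd_omega_def nowhere_dense_in_def)
qed

lemma crowded_space_homeomorphic:
  assumes f: "homeomorphic_map X Y f" and "crowded_space X"
  shows "crowded_space Y"
  unfolding crowded_space_def
proof (intro ballI notI)
  fix y assume "y \<in> topspace Y" "openin Y {y}"
  then obtain x where "x \<in> topspace X" "y = f x"
    using f by (auto simp: homeomorphic_eq_everything_map)
  moreover from this have "openin X {x}"
    using homeomorphic_map_openness [OF f, of "{x}"] \<open>openin Y {y}\<close> by simp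
  ultimately show False using assms(2) by (auto simp: crowded_space_def)
qed

text \<open>Pulling back along the inverse of \<open>e\<close> on its range transports the topology
  into a prescribed type.\<close>

lemma homeomorphic_copy:
  fixes X :: "'a topology" and e :: "'a \<Rightarrow> 'b"
  assumes "inj e"
  obtains Y where "homeomorphic_map X Y e"
proof -
  let ?Y = "pullback_topology (range e) (inv e) X"
  have op: "openin ?Y V \<longleftrightarrow> (\<exists>U. openin X U \<and> V = e ` U)" for V
  proof -
    have "inv e -` U \<inter> range e = e ` U" for U using assms by auto
    then show ?thesis by (simp add: openin_pullback_topology)
  qed
  have top: "topspace ?Y = e ` topspace X"
    using assms by (auto simp: topspace_pullback_topology)
  have "continuous_map X ?Y e"
    unfolding continuous_map_def op top
  proof (intro conjI allI impI)
    fix V assume "\<exists>U. openin X U \<and> V = e ` U"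
    then obtain U where "openin X U" "V = e ` U" by blast
    moreover have "{x \<in> topspace X. e x \<in> e ` U} = U"
      using openin_subset [OF \<open>openin X U\<close>] assms by (auto dest: injD)
    ultimately show "openin X {x \<in> topspace X. e x \<in> V}" by simp
  qed auto
  moreover have "open_map X ?Y e" unfolding open_map_def op by blast
  ultimately have "homeomorphic_map X ?Y e"
    using assms top by (intro bijective_open_imp_homeomorphic_map) (auto intro: inj_on_subset)
  then show ?thesis by (rule that)
qed

section \<open>A well-order of the continuum with countable initial segments\<close>

text \<open>A separate copy of \<open>nat set\<close>, so that it can carry a well-order instead of
  inclusion.\<close>

typedef index = "UNIV :: nat set set" by simp

instantiation index :: wellorder
begin

text \<open>\<open>card_of\<close> is a well-order of least possible type, so proper initial
  segments have smaller cardinality.\<close>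

definition less_eq_index :: "index \<Rightarrow> index \<Rightarrow> bool" where
  "x \<le> y \<longleftrightarrow> (x, y) \<in> card_of (UNIV :: index set)"

definition less_index :: "index \<Rightarrow> index \<Rightarrow> bool" where
  "x < y \<longleftrightarrow> (x, y) \<in> card_of (UNIV :: index set) \<and> x \<noteq> y"

instance
proof -
  have "well_order_on (UNIV :: index set) (card_of (UNIV :: index set))"
    by (rule card_of_well_order_on)
  then have r: "refl_on (UNIV :: index set) (card_of (UNIV :: index set))"
      "trans (card_of (UNIV :: index set))" "antisym (card_of (UNIV :: index set))"
      "total_on UNIV (card_of (UNIV :: index set))" "wf (card_of (UNIV :: index set) - Id)"
    by (auto simp: well_order_on_def linear_order_on_def partial_order_on_def preorder_on_def)
  show "OFCLASS(index, wellorder_class)"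
  proof (intro_classes, goal_cases)
    case (1 x y)
    then show ?case using antisymD [OF r(3), of x y] by (auto simp: less_eq_index_def less_index_def)
  next
    case (2 x)
    then show ?case using refl_onD [OF r(1), of x] by (simp add: less_eq_index_def)
  next
    case (3 x y z)
    then show ?case using transD [OF r(2), of x y z] by (simp add: less_eq_index_def)
  next
    case (4 x y)
    then show ?case using antisymD [OF r(3), of x y] by (simp add: less_eq_index_def)
  next
    case (5 x y)
    then show ?case using r(4) refl_onD [OF r(1), of x]
      unfolding less_eq_index_def total_on_def by (cases "x = y") simp_all
  next
    case (6 P a)
    then show ?case using wf_induct_rule [OF r(5), of P a] by (simp add: less_index_def)
  qed
qed

end

lemma index_eqpoll_reals: "(UNIV :: index set) \<approx> (UNIV :: real set)"
proof -
  have "bij Rep_index"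
    by (metis Abs_index_inverse Rep_index_inverse UNIV_I o_bij comp_def id_def ext)
  then have "(UNIV :: index set) \<approx> (UNIV :: nat set set)"
    by (auto simp: eqpoll_def)
  then show ?thesis using nat_sets_eqpoll_reals eqpoll_trans by blast
qed

lemma uncountable_index: "uncountable (UNIV :: index set)"
proof
  assume "countable (UNIV :: index set)"
  moreover obtain h :: "index \<Rightarrow> real" where "bij h"
    using index_eqpoll_reals by (auto simp: eqpoll_def)
  ultimately show False
    using countable_image [of UNIV h] uncountable_UNIV_real by (simp add: bij_is_surj)
qed

text \<open>By CH an uncountable initial segment would be equipollent to the whole type,
  contradicting minimality of the cardinal order.\<close>

lemma countable_lessThan_index:
  assumes "continuum_hypothesis"
  shows "countable {..<a :: index}"
proof (rule ccontr)
  assume unc: "uncountable {..<a}"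
  obtain h :: "index \<Rightarrow> real" where h: "bij h"
    using index_eqpoll_reals by (auto simp: eqpoll_def)
  then have inj: "inj h" by (rule bij_is_inj)
  have "uncountable (h ` {..<a})"
    using unc inj by (meson countable_image_inj_on inj_on_subset subset_UNIV)
  then have "h ` {..<a} \<approx> (UNIV :: real set)"
    using assms unfolding continuum_hypothesis_def by blast
  moreover have "{..<a} \<approx> h ` {..<a}"
    using inj inj_on_image_eqpoll_self [of h "{..<a}"] eqpoll_sym inj_on_subset by blast
  ultimately have "{..<a} \<approx> (UNIV :: index set)"
    using index_eqpoll_reals by (meson eqpoll_sym eqpoll_trans)
  then have iso: "(card_of {..<a}, card_of (UNIV :: index set)) \<in> ordIso"
    using card_of_ordIso by (auto simp: eqpoll_def)
  have "{..<a} = underS (card_of (UNIV :: index set)) a"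
    by (auto simp: underS_def less_index_def)
  moreover have "a \<in> Field (card_of (UNIV :: index set))" by (simp add: Field_card_of)
  ultimately have "(card_of {..<a}, card_of (UNIV :: index set)) \<in> ordLess"
    using card_of_underS [OF card_of_Card_order, of a "UNIV :: index set"] by simp
  with iso show False using not_ordLess_ordIso by blast
qed

text \<open>A set of naturals codes a sequence of such sets by its rows, and hence a whole task.
  Uncountably many codes of one task cannot all lie in the countable segment up to
  \<open>\<beta>\<close>.\<close>

lemma cofinal_enumeration_of_tasks:
  assumes "continuum_hypothesis"
  shows "\<exists>task :: index \<Rightarrow> (nat \<Rightarrow> nat set) \<times> (nat \<Rightarrow> nat + index) \<times> (nat + index).
    \<forall>t \<beta>. \<exists>\<delta>>\<beta>. task \<delta> = t"
proof -
  define row :: "nat set \<Rightarrow> nat \<Rightarrow> nat set" where "row S n = {m. prod_encode (n, m) \<in> S}" for S n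
  have row: "\<exists>S. row S = f" for f
    by (rule exI [of _ "{k. snd (prod_decode k) \<in> f (fst (prod_decode k))}"], rule ext) (simp add: row_def)
  \<comment> \<open>Membership of 0 is a tag: with it the shifted set codes a new point, without it
    a least element codes a natural.\<close>
  define point :: "nat set \<Rightarrow> nat + index" where
    "point S = (if 0 \<in> S then Inr (Abs_index {n. Suc n \<in> S}) else Inl (LEAST n. Suc n \<in> S))" for S
  have point: "\<exists>S. point S = p" for p
  proof (cases p)
    case (Inl n)
    have "(LEAST k. Suc k \<in> {Suc n}) = n" by (rule Least_equality) auto
    then have "point {Suc n} = p" by (simp add: point_def Inl)
    then show ?thesis by blast
  next
    case (Inr \<gamma>)
    have "point (insert 0 (Suc ` Rep_index \<gamma>)) = p"
      by (simp add: point_def Inr image_iff Rep_index_inverse)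
    then show ?thesis by blast
  qed
  define code where "code \<delta> = row (Rep_index \<delta>)" for \<delta>
  \<comment> \<open>\<open>code \<delta> 1\<close> is not read by the task, so every task has uncountably many indices.\<close>
  define task where "task \<delta> = (\<lambda>n. code \<delta> (2 * n + 2), \<lambda>n. point (code \<delta> (2 * n + 3)), point (code \<delta> 0))" for \<delta>
  show ?thesis
  proof (intro exI [of _ task] allI)
    fix t :: "(nat \<Rightarrow> nat set) \<times> (nat \<Rightarrow> nat + index) \<times> (nat + index)" and \<beta>
    obtain W D y where t: "t = (W, D, y)" by (cases t)
    define d where "d n = (SOME S. point S = D n)" for n
    have d: "point (d n) = D n" for n unfolding d_def by (rule someI_ex [OF point])
    obtain s where s: "point s = y" using point [of y] by (elim exE)
    have "\<exists>\<delta>. task \<delta> = t \<and> code \<delta> 1 = Rep_index x" for x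
    proof -
      \<comment> \<open>\<open>n div 2 - 1\<close> inverts both \<open>2 * k + 2\<close> and
        \<open>2 * k + 3\<close>, the row numbers read by \<open>task\<close>.\<close>
      define f where "f n = (if n = 0 then s else if n = 1 then Rep_index x
        else if even n then W (n div 2 - 1) else d (n div 2 - 1))" for n
      obtain S where S: "row S = f" using row [of f] by (elim exE)
      have "code (Abs_index S) = f" by (simp add: code_def Abs_index_inverse S)
      then show ?thesis
        by (intro exI [of _ "Abs_index S"]) (simp add: task_def t f_def d s)
    qed
    then have "\<forall>x. \<exists>\<delta>. task \<delta> = t \<and> code \<delta> 1 = Rep_index x" by simp
    from choice [OF this] obtain h where h: "\<forall>x. task (h x) = t \<and> code (h x) 1 = Rep_index x"
      by (elim exE)
    then have "inj h" by (metis Rep_index_inject injI)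
    show "\<exists>\<delta>>\<beta>. task \<delta> = t"
    proof (rule ccontr)
      assume "\<not> ?thesis"
      then have "range h \<subseteq> insert \<beta> {..<\<beta>}" using h by (auto simp: not_less le_less)
      moreover have "countable (insert \<beta> {..<\<beta>})" using countable_lessThan_index [OF assms] by simp
      ultimately have "countable (range h)" by (rule countable_subset)
      then show False using \<open>inj h\<close> uncountable_index countable_image_inj_on [of h UNIV] by simp
    qed
  qed
qed

theorem theorem1p7:
  assumes "continuum_hypothesis"
  shows "\<exists>X :: nat set set topology.
           crowded_space X \<and> X dim_le 0 \<and> Hausdorff_space X \<and>
           selectively_pseudocompact X (Nwd_omega X) \<and>
           \<not> selectively_pseudocompact X (Scat_omega X)"
proof -
  obtain U :: "nat set set" where U: "\<forall>A\<in>U. infinite A"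
    "\<forall>A B. A \<inter> B \<in> U \<longleftrightarrow> A \<in> U \<and> B \<in> U" "\<forall>A. - A \<in> U \<longleftrightarrow> A \<notin> U"
    using free_ultrafilter_exists by (elim exE conjE)
  obtain task :: "index \<Rightarrow> (nat \<Rightarrow> nat set) \<times> (nat \<Rightarrow> nat + index) \<times> (nat + index)"
    where task: "\<forall>t \<beta>. \<exists>\<delta>>\<beta>. task \<delta> = t"
    using cofinal_enumeration_of_tasks [OF assms] by (elim exE)
  interpret staged_generators U task
    by unfold_locales (simp_all add: U task countable_lessThan_index [OF assms] uncountable_index)
  obtain G where "\<And>\<delta>. admissible G \<delta> (G \<delta>)"
    using admissible_generators_exist by blast
  then interpret staged_topology U task G by unfold_locales
  \<comment> \<open>New points become singletons and naturals become the families
    \<open>{{n}, UNIV}\<close>, which have two elements because no \<open>{n}\<close> is all of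
    \<open>nat\<close>.\<close>
  define e :: "nat + index \<Rightarrow> nat set set" where
    "e p = (case p of Inl n \<Rightarrow> {{n}, UNIV} | Inr \<gamma> \<Rightarrow> {Rep_index \<gamma>})" for p
  have "UNIV \<noteq> {n}" for n :: nat using infinite_UNIV_nat by (metis finite.emptyI finite_insert)
  then have "inj e"
    by (auto simp: inj_def e_def doubleton_eq_iff Rep_index_inject split: sum.splits)
  then obtain Y where Y: "homeomorphic_map limit_space Y e"
    by (rule homeomorphic_copy)
  then have "limit_space homeomorphic_space Y" by (rule homeomorphic_map_imp_homeomorphic_space)
  obtain e' where e': "homeomorphic_map Y limit_space e'"
    using \<open>limit_space homeomorphic_space Y\<close> homeomorphic_space homeomorphic_space_sym by metis
  have "crowded_space Y" by (rule crowded_space_homeomorphic [OF Y limit_space_crowded])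
  moreover have "Y dim_le 0"
    using cylinder_topology_dim_le_0 homeomorphic_space_dimension_le \<open>limit_space homeomorphic_space Y\<close> by blast
  moreover have "Hausdorff_space Y"
    using limit_space_Hausdorff homeomorphic_Hausdorff_space \<open>limit_space homeomorphic_space Y\<close> by blast
  moreover have "selectively_pseudocompact Y (Nwd_omega Y)"
    by (rule selectively_pseudocompact_homeomorphic_image
        [OF Y Nwd_omega_homeomorphic_image [OF Y] _ Nwd_selectively_pseudocompact])
      (simp_all add: Nwd_omega_def)
  moreover have "\<not> selectively_pseudocompact Y (Scat_omega Y)"
  proof
    assume "selectively_pseudocompact Y (Scat_omega Y)"
    then have "selectively_pseudocompact limit_space (Scat_omega limit_space)"
      by (rule selectively_pseudocompact_homeomorphic_image
          [OF e' Scat_omega_homeomorphic_image [OF e'], rotated 2]) (simp_all add: Scat_omega_def)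
    then show False using not_Scat_selectively_pseudocompact by blast
  qed
  ultimately show ?thesis by blast
qed

end
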